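(* Let $\mathbb{D}$ be the closed unit disk in $\mathbb{R}^2$, let $K:\mathbb{D}\to\mathbb{R}$ be a continuous function and let $h:\partial\mathbb{D}\to\mathbb{R}$ be a Hölder continuous function. Assume that there exists $c_0>0$ such that $K(x)\le -c_0^2$ for all $x\in\mathbb{D}$ and $h(x)\le c_0$ for all $x\in\partial\mathbb{D}$. Then the problem $$\begin{cases} -\Delta u = 2K(x)e^{u} & \text{in } \mathbb{D},\\[2pt] \dfrac{\partial u}{\partial\nu}+2 = 2h(x)e^{u/2} & \text{on } \partial\mathbb{D},\end{cases}$$ has no solution.
   Context: $\nu$ is the outward unit normal to $\partial\mathbb{D}$. The problem is the Euler–Lagrange equation of the functional $\mathcal{I}:H^1(\mathbb{D})\to\mathbb{R}$, $\mathcal{I}(u)=\int_{\mathbb{D}}\left(\frac12|\nabla u|^2-2K e^u\right)+\int_{\partial\mathbb{D}}\left(2u-4he^{u/2}\right)$; a solution is a critical point of $\mathcal{I}$ in $H^1(\mathbb{D})$, i.e. a weak solution of the boundary value problem. *)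

theory Defs
  imports "HOL-Analysis.Analysis"
begin

text \<open>The plane is \<open>real \<times> real\<close>, whose norm, inner product and \<open>lborel\<close> are the Euclidean ones.\<close>

definition disk_measure :: "(real \<times> real) measure" where
  "disk_measure = restrict_space lborel (cball 0 1)"

text \<open>Arc length on the unit circle. Its sigma-algebra lives on the circle itself, so that a function
  that is continuous on the circle is measurable whatever its values elsewhere.\<close>

definition circle_measure :: "(real \<times> real) measure" where
  "circle_measure =
     distr (restrict_space lborel {0..<2 * pi}) (restrict_space borel (sphere 0 1))
       (\<lambda>\<theta>. (cos \<theta>, sin \<theta>))"

definition L2 :: "'a measure \<Rightarrow> ('a \<Rightarrow> 'b::euclidean_space) \<Rightarrow> bool" where
  "L2 M f \<longleftrightarrow> f \<in> borel_measurable M \<and> integrable M (\<lambda>x. (norm (f x))\<^sup>2)"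

definition L2_converges ::
  "'a measure \<Rightarrow> (nat \<Rightarrow> 'a \<Rightarrow> 'b::euclidean_space) \<Rightarrow> ('a \<Rightarrow> 'b) \<Rightarrow> bool" where
  "L2_converges M F f \<longleftrightarrow>
     (\<forall>n. L2 M (F n)) \<and> L2 M f \<and> (\<lambda>n. \<integral>x. (norm (F n x - f x))\<^sup>2 \<partial>M) \<longlonglongrightarrow> 0"

definition C1_gradient :: "(real \<times> real \<Rightarrow> real) \<Rightarrow> (real \<times> real \<Rightarrow> real \<times> real) \<Rightarrow> bool" where
  "C1_gradient f G \<longleftrightarrow> (\<forall>x. GDERIV f x :> G x) \<and> continuous_on UNIV G"

text \<open>The test functions are the \<open>C\<^sup>1\<close> functions with compact support in the open disk. By
  mollification they define the same weak gradient as the smooth ones. The identity is vector-valued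
  and comprises both partial derivatives.\<close>

definition weak_gradient :: "(real \<times> real \<Rightarrow> real) \<Rightarrow> (real \<times> real \<Rightarrow> real \<times> real) \<Rightarrow> bool" where
  "weak_gradient u g \<longleftrightarrow>
     (\<forall>\<psi> D S. C1_gradient \<psi> D \<and> compact S \<and> S \<subseteq> ball 0 1 \<and> (\<forall>x. x \<notin> S \<longrightarrow> \<psi> x = 0) \<longrightarrow>
        (\<integral>x. u x *\<^sub>R D x \<partial>disk_measure) = - (\<integral>x. \<psi> x *\<^sub>R g x \<partial>disk_measure))"

text \<open>\<open>H1_disk u g\<close>: the function \<open>u\<close> belongs to the Sobolev space \<open>H\<^sup>1\<close> of the disk, and \<open>g\<close>
  is its gradient (unique almost everywhere).\<close>

definition H1_disk :: "(real \<times> real \<Rightarrow> real) \<Rightarrow> (real \<times> real \<Rightarrow> real \<times> real) \<Rightarrow> bool" where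
  "H1_disk u g \<longleftrightarrow> L2 disk_measure u \<and> L2 disk_measure g \<and> weak_gradient u g"

text \<open>The trace operator is the continuous extension to \<open>H\<^sup>1\<close>, with values in \<open>L\<^sup>2\<close> of the circle, of
  the restriction of \<open>C\<^sup>1\<close> functions on the closed disk. Every \<open>H\<^sup>1\<close> function has a trace, and it is
  unique almost everywhere on the circle.\<close>

definition H1_trace ::
  "(real \<times> real \<Rightarrow> real) \<Rightarrow> (real \<times> real \<Rightarrow> real \<times> real) \<Rightarrow> (real \<times> real \<Rightarrow> real) \<Rightarrow> bool" where
  "H1_trace u g \<tau> \<longleftrightarrow> H1_disk u g \<and>
     (\<exists>F G. (\<forall>n. C1_gradient (F n) (G n)) \<and> L2_converges disk_measure F u \<and>
        L2_converges disk_measure G g \<and> L2_converges circle_measure F \<tau>)"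

text \<open>The functional at \<open>u\<close> is \<open>energy K h u g \<tau>\<close> with \<open>g\<close> the gradient and \<open>\<tau>\<close> the trace of \<open>u\<close>. It does
  not depend on their representatives. For continuous \<open>K\<close> and \<open>h\<close> the integrands are integrable for
  every \<open>H\<^sup>1\<close> function, by the Moser--Trudinger inequalities on the disk and on its boundary.\<close>

definition energy ::
  "(real \<times> real \<Rightarrow> real) \<Rightarrow> (real \<times> real \<Rightarrow> real) \<Rightarrow>
   (real \<times> real \<Rightarrow> real) \<Rightarrow> (real \<times> real \<Rightarrow> real \<times> real) \<Rightarrow> (real \<times> real \<Rightarrow> real) \<Rightarrow> real" where
  "energy K h u g \<tau> =
     (\<integral>x. (norm (g x))\<^sup>2 / 2 - 2 * K x * exp (u x) \<partial>disk_measure) +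
     (\<integral>x. 2 * \<tau> x - 4 * h x * exp (\<tau> x / 2) \<partial>circle_measure)"

text \<open>A solution of \<open>-\<Delta>u = 2Ke\<^sup>u\<close> in the disk with \<open>\<partial>u/\<partial>\<nu> + 2 = 2he\<^bsup>u/2\<^esup>\<close> on the circle is a
  critical point of the functional in \<open>H\<^sup>1\<close>: all its directional derivatives vanish. Gradient and
  trace are linear, which gives those of \<open>u + t\<phi>\<close>.\<close>

definition solution :: "(real \<times> real \<Rightarrow> real) \<Rightarrow> (real \<times> real \<Rightarrow> real) \<Rightarrow> (real \<times> real \<Rightarrow> real) \<Rightarrow> bool" where
  "solution K h u \<longleftrightarrow>
     (\<exists>g \<tau>. H1_trace u g \<tau> \<and>
        (\<forall>\<phi> d \<sigma>. H1_trace \<phi> d \<sigma> \<longrightarrow>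
           ((\<lambda>t. energy K h (\<lambda>x. u x + t * \<phi> x) (\<lambda>x. g x + t *\<^sub>R d x) (\<lambda>x. \<tau> x + t * \<sigma> x))
              has_real_derivative 0) (at 0)))"

definition holder_continuous_on :: "'a::metric_space set \<Rightarrow> ('a \<Rightarrow> real) \<Rightarrow> bool" where
  "holder_continuous_on S f \<longleftrightarrow>
     (\<exists>\<alpha> C. 0 < \<alpha> \<and> \<alpha> \<le> 1 \<and> (\<forall>x\<in>S. \<forall>y\<in>S. \<bar>f x - f y\<bar> \<le> C * dist x y powr \<alpha>))"

end

theory Submission
  imports Defs
begin

text \<open>A solution \<open>u\<close> would make \<open>e\<^sup>u |dx|\<^sup>2\<close> a metric on the disk with curvature \<open>K \<le> - c\<^sup>2\<close>
  whose boundary has geodesic curvature \<open>h \<le> c\<close>, while a disk in the hyperbolic plane of curvature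
  \<open>- c\<^sup>2\<close> has boundary curvature larger than \<open>c\<close>. The comparison metrics are
  \<open>4 R\<^sup>2 |dx|\<^sup>2 / (c\<^sup>2 (R\<^sup>2 - |x|\<^sup>2)\<^sup>2)\<close> with \<open>R > |x|\<close>. Let \<open>R(x)\<close> be the parameter for which the
  comparison metric agrees with \<open>e\<^sup>u |dx|\<^sup>2\<close> at \<open>x\<close>; explicitly, \<open>q = log (R / |x|)\<close> satisfies
  \<open>sinh q = 1 / z\<close> with \<open>z = c |x| e\<^bsup>u/2\<^esup>\<close>. A smooth \<open>u\<close> would satisfy
  \<open>div (coth\<^sup>2 q \<nabla>log R) \<le> 0\<close> in the disk, while on the circle the boundary condition makes the
  normal derivative of \<open>R\<close> positive. The divergence theorem shows that this is impossible.

  For a weak solution the same contradiction is reached by a choice of test function. Put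
  \<open>\<Phi> = coth q = sqrt (1 + c\<^sup>2 |x|\<^sup>2 e\<^sup>u)\<close> and \<open>\<Gamma> = 2 (\<Phi>\<^sup>2 - \<Phi>) / |x|\<^sup>2\<close>. Test the equation with
  \<open>\<Phi>\<close> and subtract the divergence theorem for the field \<open>\<Gamma> x\<close>. The integrand over the disk
  is then bounded below by
  \<open>c\<^sup>2 e\<^sup>u / (2 \<Phi>) (|x|\<^sup>2 |\<nabla>u|\<^sup>2 - X\<^sup>2 + (X + 2 - 2 \<Phi>)\<^sup>2) \<ge> 0\<close> with \<open>X = x \<bullet> \<nabla>u\<close>
  (\<open>interior_density_nonneg\<close>), and the one over the circle is at most \<open>2 z \<Phi> - 2 \<Phi>\<^sup>2 \<le> - 1\<close>, because
  \<open>\<Phi>\<^sup>2 - z\<^sup>2 = 1\<close> there. The two integrals cannot be equal.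

  The rest is analysis that makes this legitimate in \<open>H\<^sup>1\<close>. The functional is differentiable in bounded
  directions because \<open>u\<close> and its trace are exponentially integrable (\<open>H1_exp_integrable\<close>); this
  follows from a Gagliardo--Nirenberg inequality on the disk (\<open>Gagliardo_Nirenberg_disk\<close>).
  The divergence theorem (\<open>Gauss_Green_disk\<close>) and the chain rule (\<open>H1_trace_compose\<close>) pass from
  \<open>C\<^sup>1\<close> functions to \<open>H\<^sup>1\<close> by approximation. Finally \<open>u\<close> is truncated inside \<open>\<Phi>\<close> and
  \<open>\<Gamma>\<close>, so that the test function is bounded, and the truncation is removed by dominated
  convergence.\<close>

section \<open>Integrals over the disk and the circle\<close>

lemma space_disk_measure [simp]: "space disk_measure = cball 0 1"
  by (simp add: disk_measure_def space_restrict_space)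

lemma sets_disk_measure [measurable_cong]:
  "sets disk_measure = sets (restrict_space borel (cball 0 1))"
  unfolding disk_measure_def by (rule sets_restrict_space_cong) simp

lemma finite_disk_measure: "finite_measure disk_measure"
proof
  have "emeasure lborel (cball 0 1 :: (real \<times> real) set) < \<infinity>"
    by (rule emeasure_bounded_finite) simp
  then show "emeasure disk_measure (space disk_measure) \<noteq> \<infinity>"
    by (simp add: disk_measure_def emeasure_restrict_space)
qed

interpretation disk: finite_measure disk_measure
  by (rule finite_disk_measure)

lemma cos_sin_measurable:
  "(\<lambda>\<theta>. (cos \<theta>, sin \<theta>)) \<in> restrict_space lborel {0..<2 * pi} \<rightarrow>\<^sub>M restrict_space borel (sphere 0 1)"
proof (rule measurable_restrict_space2)
  show "(\<lambda>\<theta>. (cos \<theta>, sin \<theta>)) \<in> space (restrict_space lborel {0..<2 * pi}) \<rightarrow> (sphere 0 1 :: (real \<times> real) set)"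
    by (auto simp: norm_Pair)
  have "(\<lambda>\<theta>::real. (cos \<theta>, sin \<theta>)) \<in> borel_measurable borel"
    by (intro borel_measurable_continuous_onI continuous_intros)
  then show "(\<lambda>\<theta>. (cos \<theta>, sin \<theta>)) \<in> borel_measurable (restrict_space lborel {0..<2 * pi})"
    by (simp add: measurable_restrict_space1)
qed

lemma space_circle_measure [simp]: "space circle_measure = sphere 0 1"
  by (simp add: circle_measure_def space_restrict_space)

lemma sets_circle_measure [measurable_cong]:
  "sets circle_measure = sets (restrict_space borel (sphere 0 1))"
  unfolding circle_measure_def by simp

lemma emeasure_circle_measure:
  "emeasure circle_measure (sphere 0 1) = ennreal (2 * pi)"
proof -
  have "emeasure circle_measure (sphere 0 1) =
    emeasure (restrict_space lborel {0..<2 * pi})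
      ((\<lambda>\<theta>. (cos \<theta>, sin \<theta>)) -` sphere 0 1 \<inter> space (restrict_space lborel {0..<2 * pi}))"
    unfolding circle_measure_def
    by (rule emeasure_distr[OF cos_sin_measurable]) (auto simp: sets_restrict_space)
  also have "(\<lambda>\<theta>. (cos \<theta>, sin \<theta>)) -` sphere 0 1 \<inter> space (restrict_space lborel {0..<2 * pi}) = {0..<2*pi}"
    by (auto simp: norm_Pair space_restrict_space)
  also have "emeasure (restrict_space lborel {0..<2 * pi}) {0..<2*pi} = ennreal (2 * pi)"
    by (subst emeasure_restrict_space) auto
  finally show ?thesis .
qed

lemma finite_circle_measure: "finite_measure circle_measure"
  by standard (simp add: emeasure_circle_measure)

interpretation circle: finite_measure circle_measure
  by (rule finite_circle_measure)

lemma measurable_disk_continuous: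
  assumes "continuous_on (cball 0 1) f"
  shows "f \<in> borel_measurable disk_measure"
  using borel_measurable_continuous_on_restrict[OF assms]
  by (simp add: measurable_cong_sets[OF sets_disk_measure refl])

lemma measurable_circle_continuous:
  assumes "continuous_on (sphere 0 1) f"
  shows "f \<in> borel_measurable circle_measure"
  using borel_measurable_continuous_on_restrict[OF assms]
  by (simp add: measurable_cong_sets[OF sets_circle_measure refl])

lemma integrable_disk_continuous:
  fixes f :: "real \<times> real \<Rightarrow> 'b::euclidean_space"
  assumes "continuous_on (cball 0 1) f"
  shows "integrable disk_measure f"
proof -
  have "bounded (f ` cball 0 1)"
    by (intro compact_imp_bounded compact_continuous_image assms compact_cball)
  then obtain B where "\<And>x. x \<in> cball 0 1 \<Longrightarrow> norm (f x) \<le> B"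
    unfolding bounded_iff by blast
  then show ?thesis
    by (intro disk.integrable_const_bound[of _ B] measurable_disk_continuous assms AE_I2) auto
qed

lemma integrable_circle_continuous:
  fixes f :: "real \<times> real \<Rightarrow> 'b::euclidean_space"
  assumes "continuous_on (sphere 0 1) f"
  shows "integrable circle_measure f"
proof -
  have "bounded (f ` sphere 0 1)"
    by (intro compact_imp_bounded compact_continuous_image assms compact_sphere)
  then obtain B where "\<And>x. x \<in> sphere 0 1 \<Longrightarrow> norm (f x) \<le> B"
    unfolding bounded_iff by blast
  then show ?thesis
    by (intro circle.integrable_const_bound[of _ B] measurable_circle_continuous assms AE_I2) auto
qed

lemma continuous_on_circle_param [continuous_intros]:
  assumes "continuous_on UNIV f"
  shows "continuous_on A (\<lambda>\<theta>::real. f (cos \<theta>, sin \<theta>))"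
  by (rule continuous_on_compose2[OF assms]) (auto intro!: continuous_intros)

lemma circle_integral_eq:
  fixes f :: "real \<times> real \<Rightarrow> real"
  assumes f: "continuous_on UNIV f"
  shows "(\<integral>x. f x \<partial>circle_measure) = integral {0..2*pi} (\<lambda>\<theta>. f (cos \<theta>, sin \<theta>))"
proof -
  let ?g = "\<lambda>\<theta>. f (cos \<theta>, sin \<theta>)"
  have fm: "f \<in> borel_measurable (restrict_space borel (sphere 0 1))"
    by (rule borel_measurable_continuous_on_restrict) (rule continuous_on_subset[OF f], simp)
  have "(\<integral>x. f x \<partial>circle_measure) = (\<integral>\<theta>. ?g \<theta> \<partial>(restrict_space lborel {0..<2 * pi}))"
    unfolding circle_measure_def by (rule integral_distr[OF cos_sin_measurable fm])
  also have "\<dots> = (LINT \<theta>:{0..<2*pi}|lborel. ?g \<theta>)"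
    by (simp add: integral_restrict_space set_lebesgue_integral_def)
  also have "\<dots> = integral {0..<2*pi} ?g"
    by (rule set_borel_integral_eq_integral)
      (rule set_integrable_subset[OF borel_integrable_atLeastAtMost'[of 0 "2*pi"]],
        auto intro!: continuous_intros f)
  also have "\<dots> = integral {0..2*pi} ?g"
    by (rule integral_subset_negligible) (auto intro!: negligible_subset[of "{2*pi}"])
  finally show ?thesis .
qed

lemma continuous_on_half_circles:
  assumes "continuous_on UNIV f"
  shows "continuous_on {-1..1::real} (\<lambda>y. f (sqrt (1 - y\<^sup>2), y))"
    "continuous_on {-1..1::real} (\<lambda>y. f (- sqrt (1 - y\<^sup>2), y))"
    "continuous_on {-1..1::real} (\<lambda>y. f (y, sqrt (1 - y\<^sup>2)))"
    "continuous_on {-1..1::real} (\<lambda>y. f (y, - sqrt (1 - y\<^sup>2)))"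
  by (rule continuous_on_compose2[OF assms], auto intro!: continuous_intros)+

text \<open>Substituting \<open>y = sin \<theta>\<close> on the two halves of the circle that are graphs over the vertical
  axis; the sign of \<open>cos\<close> decides which half is parametrised.\<close>

lemma right_arc_integral:
  fixes f :: "real \<times> real \<Rightarrow> real"
  assumes f: "continuous_on UNIV f"
  shows "integral {-1..1} (\<lambda>y. f (sqrt (1 - y\<^sup>2), y)) =
    integral {0..pi/2} (\<lambda>\<theta>. cos \<theta> * f (cos \<theta>, sin \<theta>)) +
    integral {3*pi/2..2*pi} (\<lambda>\<theta>. cos \<theta> * f (cos \<theta>, sin \<theta>))"
proof -
  let ?p = "\<lambda>y. f (sqrt (1 - y\<^sup>2), y)"
  note c = continuous_on_half_circles(1)[OF f]
  have s: "sin (3*pi/2) = -1" using sin_3over2_pi by (simp add: algebra_simps)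
  have pos: "cos \<theta> \<ge> 0" if "\<theta> \<in> {0..pi/2} \<or> \<theta> \<in> {3*pi/2..2*pi}" for \<theta>
  proof -
    have "cos (2*pi - \<theta>) = cos \<theta>" by (simp add: cos_diff)
    with that show ?thesis
      using cos_ge_zero[of \<theta>] cos_ge_zero[of "2*pi - \<theta>"] by auto
  qed
  have rt: "sqrt (1 - (sin \<theta>)\<^sup>2) = cos \<theta>" if "\<theta> \<in> {0..pi/2} \<or> \<theta> \<in> {3*pi/2..2*pi}" for \<theta>
    using pos[OF that] by (metis cos_squared_eq real_sqrt_abs abs_of_nonneg)
  have 1: "((\<lambda>\<theta>. cos \<theta> *\<^sub>R ?p (sin \<theta>)) has_integral
      (integral {sin 0..sin (pi/2)} ?p - integral {sin (pi/2)..sin 0} ?p)) {0..pi/2}"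
    by (rule has_integral_substitution_general[where s="{}" and c="-1" and d=1, OF _ _ _ c])
      (auto intro!: continuous_intros derivative_eq_intros)
  have 2: "((\<lambda>\<theta>. cos \<theta> *\<^sub>R ?p (sin \<theta>)) has_integral
      (integral {sin (3*pi/2)..sin (2*pi)} ?p - integral {sin (2*pi)..sin (3*pi/2)} ?p)) {3*pi/2..2*pi}"
    by (rule has_integral_substitution_general[where s="{}" and c="-1" and d=1, OF _ _ _ c])
      (auto intro!: continuous_intros derivative_eq_intros)
  have "integral {0..pi/2} (\<lambda>\<theta>. cos \<theta> * f (cos \<theta>, sin \<theta>)) = integral {0..pi/2} (\<lambda>\<theta>. cos \<theta> * ?p (sin \<theta>))"
    by (rule integral_cong) (simp add: rt)
  then have e1: "integral {0..pi/2} (\<lambda>\<theta>. cos \<theta> * f (cos \<theta>, sin \<theta>)) = integral {0..1} ?p"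
    using integral_unique[OF 1] by (simp)
  have "integral {3*pi/2..2*pi} (\<lambda>\<theta>. cos \<theta> * f (cos \<theta>, sin \<theta>)) = integral {3*pi/2..2*pi} (\<lambda>\<theta>. cos \<theta> * ?p (sin \<theta>))"
    by (rule integral_cong) (simp add: rt)
  then have e2: "integral {3*pi/2..2*pi} (\<lambda>\<theta>. cos \<theta> * f (cos \<theta>, sin \<theta>)) = integral {-1..0} ?p"
    using integral_unique[OF 2] by (simp add: s)
  have "integral {-1..0} ?p + integral {0..1} ?p = integral {-1..1} ?p"
    by (rule Henstock_Kurzweil_Integration.integral_combine) (auto intro!: integrable_continuous_real c)
  with e1 e2 show ?thesis by simp
qed

lemma left_arc_integral:
  fixes f :: "real \<times> real \<Rightarrow> real"
  assumes f: "continuous_on UNIV f"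
  shows "integral {-1..1} (\<lambda>y. f (- sqrt (1 - y\<^sup>2), y)) =
    - integral {pi/2..3*pi/2} (\<lambda>\<theta>. cos \<theta> * f (cos \<theta>, sin \<theta>))"
proof -
  let ?p = "\<lambda>y. f (- sqrt (1 - y\<^sup>2), y)"
  note c = continuous_on_half_circles(2)[OF f]
  have s: "sin (3*pi/2) = -1" using sin_3over2_pi by (simp add: algebra_simps)
  have rt: "- sqrt (1 - (sin \<theta>)\<^sup>2) = cos \<theta>" if "\<theta> \<in> {pi/2..3*pi/2}" for \<theta>
  proof -
    have "cos (\<theta> - pi) = - cos \<theta>" by (simp add: cos_diff)
    then have "cos \<theta> \<le> 0" using that cos_ge_zero[of "\<theta> - pi"] by auto
    then show ?thesis by (metis cos_squared_eq real_sqrt_abs abs_of_nonpos minus_minus)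
  qed
  have 1: "((\<lambda>\<theta>. cos \<theta> *\<^sub>R ?p (sin \<theta>)) has_integral
      (integral {sin (pi/2)..sin (3*pi/2)} ?p - integral {sin (3*pi/2)..sin (pi/2)} ?p)) {pi/2..3*pi/2}"
    by (rule has_integral_substitution_general[where s="{}" and c="-1" and d=1, OF _ _ _ c])
      (auto intro!: continuous_intros derivative_eq_intros)
  have "integral {pi/2..3*pi/2} (\<lambda>\<theta>. cos \<theta> * f (cos \<theta>, sin \<theta>)) = integral {pi/2..3*pi/2} (\<lambda>\<theta>. cos \<theta> * ?p (sin \<theta>))"
    by (rule integral_cong) (simp add: rt)
  then show ?thesis
    using integral_unique[OF 1] by (simp add: s)
qed

lemma upper_arc_integral:
  fixes f :: "real \<times> real \<Rightarrow> real"
  assumes f: "continuous_on UNIV f"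
  shows "integral {-1..1} (\<lambda>x. f (x, sqrt (1 - x\<^sup>2))) =
    integral {0..pi} (\<lambda>\<theta>. sin \<theta> * f (cos \<theta>, sin \<theta>))"
proof -
  let ?p = "\<lambda>x. f (x, sqrt (1 - x\<^sup>2))"
  note c = continuous_on_half_circles(3)[OF f]
  have rt: "sqrt (1 - (cos \<theta>)\<^sup>2) = sin \<theta>" if "\<theta> \<in> {0..pi}" for \<theta>
    using that sin_ge_zero[of \<theta>] by (metis atLeastAtMost_iff sin_squared_eq real_sqrt_abs abs_of_nonneg)
  have 1: "((\<lambda>\<theta>. (- sin \<theta>) *\<^sub>R ?p (cos \<theta>)) has_integral
      (integral {cos 0..cos pi} ?p - integral {cos pi..cos 0} ?p)) {0..pi}"
    by (rule has_integral_substitution_general[where s="{}" and c="-1" and d=1, OF _ _ _ c])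
      (auto intro!: continuous_intros derivative_eq_intros)
  have "integral {0..pi} (\<lambda>\<theta>. sin \<theta> * f (cos \<theta>, sin \<theta>)) = integral {0..pi} (\<lambda>\<theta>. sin \<theta> * ?p (cos \<theta>))"
    by (rule integral_cong) (simp add: rt)
  then show ?thesis
    using integral_unique[OF 1] by (simp)
qed

lemma lower_arc_integral:
  fixes f :: "real \<times> real \<Rightarrow> real"
  assumes f: "continuous_on UNIV f"
  shows "integral {-1..1} (\<lambda>x. f (x, - sqrt (1 - x\<^sup>2))) =
    - integral {pi..2*pi} (\<lambda>\<theta>. sin \<theta> * f (cos \<theta>, sin \<theta>))"
proof -
  let ?p = "\<lambda>x. f (x, - sqrt (1 - x\<^sup>2))"
  note c = continuous_on_half_circles(4)[OF f]
  have rt: "- sqrt (1 - (cos \<theta>)\<^sup>2) = sin \<theta>" if "\<theta> \<in> {pi..2*pi}" for \<theta>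
  proof -
    have "sin (\<theta> - pi) = - sin \<theta>" by (simp add: sin_diff)
    then have "sin \<theta> \<le> 0" using that sin_ge_zero[of "\<theta> - pi"] by auto
    then show ?thesis by (metis sin_squared_eq real_sqrt_abs abs_of_nonpos minus_minus)
  qed
  have 1: "((\<lambda>\<theta>. (- sin \<theta>) *\<^sub>R ?p (cos \<theta>)) has_integral
      (integral {cos pi..cos (2*pi)} ?p - integral {cos (2*pi)..cos pi} ?p)) {pi..2*pi}"
    by (rule has_integral_substitution_general[where s="{}" and c="-1" and d=1, OF _ _ _ c])
      (auto intro!: continuous_intros derivative_eq_intros)
  have "integral {pi..2*pi} (\<lambda>\<theta>. sin \<theta> * f (cos \<theta>, sin \<theta>)) = integral {pi..2*pi} (\<lambda>\<theta>. sin \<theta> * ?p (cos \<theta>))"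
    by (rule integral_cong) (simp add: rt)
  then show ?thesis
    using integral_unique[OF 1] by (simp)
qed

lemma circle_integral_split:
  fixes f :: "real \<times> real \<Rightarrow> real"
  assumes f: "continuous_on UNIV f"
  shows "(\<integral>x. fst x * f x \<partial>circle_measure) =
      integral {-1..1} (\<lambda>y. f (sqrt (1 - y\<^sup>2), y)) - integral {-1..1} (\<lambda>y. f (- sqrt (1 - y\<^sup>2), y))"
    and "(\<integral>x. snd x * f x \<partial>circle_measure) =
      integral {-1..1} (\<lambda>x. f (x, sqrt (1 - x\<^sup>2))) - integral {-1..1} (\<lambda>x. f (x, - sqrt (1 - x\<^sup>2)))"
proof -
  have c: "continuous_on UNIV (\<lambda>x. fst x * f x)" "continuous_on UNIV (\<lambda>x. snd x * f x)"
    using f by (auto intro!: continuous_intros)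
  let ?g = "\<lambda>\<theta>. cos \<theta> * f (cos \<theta>, sin \<theta>)" and ?h = "\<lambda>\<theta>. sin \<theta> * f (cos \<theta>, sin \<theta>)"
  have i: "?g integrable_on {a..b}" "?h integrable_on {a..b}" for a b
    by (auto intro!: integrable_continuous_real continuous_intros f)
  have "integral {0..pi/2} ?g + integral {pi/2..2*pi} ?g = integral {0..2*pi} ?g"
    "integral {pi/2..3*pi/2} ?g + integral {3*pi/2..2*pi} ?g = integral {pi/2..2*pi} ?g"
    "integral {0..pi} ?h + integral {pi..2*pi} ?h = integral {0..2*pi} ?h"
    by (rule Henstock_Kurzweil_Integration.integral_combine[OF _ _ i(1)] 
        Henstock_Kurzweil_Integration.integral_combine[OF _ _ i(2)]; simp)+
  with circle_integral_eq[OF c(1)] circle_integral_eq[OF c(2)]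
  show "(\<integral>x. fst x * f x \<partial>circle_measure) =
      integral {-1..1} (\<lambda>y. f (sqrt (1 - y\<^sup>2), y)) - integral {-1..1} (\<lambda>y. f (- sqrt (1 - y\<^sup>2), y))"
    and "(\<integral>x. snd x * f x \<partial>circle_measure) =
      integral {-1..1} (\<lambda>x. f (x, sqrt (1 - x\<^sup>2))) - integral {-1..1} (\<lambda>x. f (x, - sqrt (1 - x\<^sup>2)))"
    by (simp_all add: right_arc_integral[OF f] left_arc_integral[OF f]
        upper_arc_integral[OF f] lower_arc_integral[OF f])
qed

lemma arc_integral_le:
  fixes f :: "real \<times> real \<Rightarrow> real"
  assumes f: "continuous_on UNIV f" and pos: "\<And>x. 0 \<le> f x"
  shows "integral {-1..1} (\<lambda>y. f (sqrt (1 - y\<^sup>2), y)) \<le> (\<integral>x. f x \<partial>circle_measure)"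
    and "integral {-1..1} (\<lambda>x. f (x, sqrt (1 - x\<^sup>2))) \<le> (\<integral>x. f x \<partial>circle_measure)"
proof -
  let ?f = "\<lambda>\<theta>. f (cos \<theta>, sin \<theta>)"
  have i: "?f integrable_on {a..b}" for a b
    by (auto intro!: integrable_continuous_real continuous_intros f)
  have le: "integral {a..b} (\<lambda>\<theta>. cos \<theta> * ?f \<theta>) \<le> integral {a..b} ?f"
    "integral {a..b} (\<lambda>\<theta>. sin \<theta> * ?f \<theta>) \<le> integral {a..b} ?f" for a b
    using mult_right_mono[OF cos_le_one pos] mult_right_mono[OF sin_le_one pos]
    by (auto intro!: integral_le integrable_continuous_real continuous_intros f)
  have nn: "0 \<le> integral {a..b} ?f" for a b
    by (rule Henstock_Kurzweil_Integration.integral_nonneg[OF i]) (simp add: pos)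
  have "integral {0..pi/2} ?f + integral {pi/2..2*pi} ?f = integral {0..2*pi} ?f"
    "integral {pi/2..3*pi/2} ?f + integral {3*pi/2..2*pi} ?f = integral {pi/2..2*pi} ?f"
    "integral {0..pi} ?f + integral {pi..2*pi} ?f = integral {0..2*pi} ?f"
    by (rule Henstock_Kurzweil_Integration.integral_combine[OF _ _ i]; simp)+
  with le nn[of "pi/2" "3*pi/2"] nn[of pi "2*pi"] 
  show "integral {-1..1} (\<lambda>y. f (sqrt (1 - y\<^sup>2), y)) \<le> (\<integral>x. f x \<partial>circle_measure)"
    and "integral {-1..1} (\<lambda>x. f (x, sqrt (1 - x\<^sup>2))) \<le> (\<integral>x. f x \<partial>circle_measure)"
    unfolding circle_integral_eq[OF f] right_arc_integral[OF f] upper_arc_integral[OF f]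
    by (smt (verit, best))+
qed

section \<open>The divergence theorem for continuously differentiable functions\<close>

lemma C1_gradient_continuous:
  assumes "C1_gradient f G"
  shows "continuous_on A f" "continuous_on A G"
proof -
  show "continuous_on A f"
    using assms unfolding C1_gradient_def gderiv_def
    by (intro differentiable_imp_continuous_on)
      (auto simp: differentiable_on_def differentiable_def intro: has_derivative_at_withinI)
  show "continuous_on A G"
    using assms unfolding C1_gradient_def by (auto intro: continuous_on_subset)
qed

lemma C1_gradient_partial_derivatives:
  assumes "C1_gradient f G"
  shows "((\<lambda>s. f (s, y)) has_real_derivative fst (G (x, y))) (at x within A)"
    and "((\<lambda>s. f (x, s)) has_real_derivative snd (G (x, y))) (at y within A)"
proof -
  have d: "(f has_derivative (\<lambda>h. h \<bullet> G p)) (at p)" for p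
    using assms unfolding C1_gradient_def gderiv_def by blast
  have "((\<lambda>s. f (s, y)) has_derivative (\<lambda>h. (h, 0) \<bullet> G (x, y))) (at x within A)"
    by (rule has_derivative_compose[where f="\<lambda>s. (s, y)", OF _ d]) (auto intro!: derivative_eq_intros)
  moreover have "((\<lambda>s. f (x, s)) has_derivative (\<lambda>h. (0, h) \<bullet> G (x, y))) (at y within A)"
    by (rule has_derivative_compose[where f="\<lambda>s. (x, s)", OF _ d]) (auto intro!: derivative_eq_intros)
  ultimately show "((\<lambda>s. f (s, y)) has_real_derivative fst (G (x, y))) (at x within A)"
    and "((\<lambda>s. f (x, s)) has_real_derivative snd (G (x, y))) (at y within A)"
    by (simp_all add: has_field_derivative_def inner_prod_def mult_commute_abs)
qed

abbreviation (input) unit_disk :: "(real \<times> real) set" where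
  "unit_disk \<equiv> cball 0 1"

lemma disk_integral_lborel:
  "(\<integral>x. F x \<partial>disk_measure) = (\<integral>x. indicator unit_disk x *\<^sub>R F x \<partial>lborel)"
  for F :: "real \<times> real \<Rightarrow> 'b::euclidean_space"
  unfolding disk_measure_def by (rule integral_restrict_space) simp

lemma disk_Fubini:
  fixes F :: "real \<times> real \<Rightarrow> real"
  assumes F: "continuous_on UNIV F"
  shows "integrable lborel (\<lambda>y. \<integral>x. indicator unit_disk (x, y) * F (x, y) \<partial>lborel)"
    and "(\<integral>x. F x \<partial>disk_measure) = (\<integral>y. \<integral>x. indicator unit_disk (x, y) * F (x, y) \<partial>lborel \<partial>lborel)"
    and "integrable lborel (\<lambda>x. \<integral>y. indicator unit_disk (x, y) * F (x, y) \<partial>lborel)"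
    and "(\<integral>x. F x \<partial>disk_measure) = (\<integral>x. \<integral>y. indicator unit_disk (x, y) * F (x, y) \<partial>lborel \<partial>lborel)"
proof -
  let ?k = "\<lambda>p. indicator unit_disk p * F p"
  have "integrable lborel (\<lambda>p. indicator unit_disk p *\<^sub>R F p)"
    by (intro borel_integrable_compact compact_cball continuous_on_subset[OF F]) simp
  then have i: "integrable (lborel \<Otimes>\<^sub>M lborel) (case_prod (\<lambda>x y. ?k (x, y)))"
    by (simp add: lborel_prod case_prod_unfold)
  have e: "(\<integral>x. F x \<partial>disk_measure) = integral\<^sup>L (lborel \<Otimes>\<^sub>M lborel) (case_prod (\<lambda>x y. ?k (x, y)))"
    by (simp add: disk_integral_lborel lborel_prod case_prod_unfold)
  show "integrable lborel (\<lambda>y. \<integral>x. ?k (x, y) \<partial>lborel)"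
    using lborel_pair.integrable_snd[OF i] .
  show "integrable lborel (\<lambda>x. \<integral>y. ?k (x, y) \<partial>lborel)"
    using lborel_pair.integrable_fst[OF i] .
  show "(\<integral>x. F x \<partial>disk_measure) = (\<integral>y. \<integral>x. ?k (x, y) \<partial>lborel \<partial>lborel)"
    unfolding e by (rule lborel_pair.integral_snd[OF i, symmetric])
  show "(\<integral>x. F x \<partial>disk_measure) = (\<integral>x. \<integral>y. ?k (x, y) \<partial>lborel \<partial>lborel)"
    unfolding e by (rule lborel_pair.integral_fst[OF i, symmetric])
qed

lemma unit_disk_Pair_iff:
  "(x, y) \<in> unit_disk \<longleftrightarrow> y \<in> {-1..1} \<and> x \<in> {- sqrt (1 - y\<^sup>2)..sqrt (1 - y\<^sup>2)}"
  "(x, y) \<in> unit_disk \<longleftrightarrow> x \<in> {-1..1} \<and> y \<in> {- sqrt (1 - x\<^sup>2)..sqrt (1 - x\<^sup>2)}"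
proof -
  have *: "a\<^sup>2 + b\<^sup>2 \<le> 1 \<longleftrightarrow> b \<in> {-1..1} \<and> a \<in> {- sqrt (1 - b\<^sup>2)..sqrt (1 - b\<^sup>2)}" for a b :: real
  proof -
    have "\<bar>a\<bar> \<le> sqrt (1 - b\<^sup>2) \<longleftrightarrow> a\<^sup>2 \<le> 1 - b\<^sup>2"
      by (metis real_sqrt_abs real_sqrt_le_iff)
    moreover have "a\<^sup>2 + b\<^sup>2 \<le> 1 \<Longrightarrow> \<bar>b\<bar> \<le> 1"
      using zero_le_power2[of a] abs_square_le_1[of b] by linarith
    ultimately show ?thesis by (auto simp: abs_le_iff)
  qed
  have "(x, y) \<in> unit_disk \<longleftrightarrow> x\<^sup>2 + y\<^sup>2 \<le> 1"
    by (simp add: norm_Pair)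
  then show "(x, y) \<in> unit_disk \<longleftrightarrow> y \<in> {-1..1} \<and> x \<in> {- sqrt (1 - y\<^sup>2)..sqrt (1 - y\<^sup>2)}"
    "(x, y) \<in> unit_disk \<longleftrightarrow> x \<in> {-1..1} \<and> y \<in> {- sqrt (1 - x\<^sup>2)..sqrt (1 - x\<^sup>2)}"
    using *[of x y] *[of y x] by (simp_all add: add.commute)
qed

lemma chord_integral:
  fixes F :: "real \<times> real \<Rightarrow> real"
  assumes F: "continuous_on UNIV F"
  shows "(\<integral>x. indicator unit_disk (x, y) * F (x, y) \<partial>lborel) =
      indicator {-1..1} y * integral {- sqrt (1 - y\<^sup>2)..sqrt (1 - y\<^sup>2)} (\<lambda>x. F (x, y))"
    and "(\<integral>y. indicator unit_disk (x, y) * F (x, y) \<partial>lborel) =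
      indicator {-1..1} x * integral {- sqrt (1 - x\<^sup>2)..sqrt (1 - x\<^sup>2)} (\<lambda>y. F (x, y))"
proof -
  have c: "continuous_on A (\<lambda>x. F (x, y))" "continuous_on A (\<lambda>y. F (x, y))" for x y A
    by (auto intro!: continuous_on_compose2[OF F] continuous_intros)
  have "(LINT s:{a..b}|lborel. F (s, y)) = integral {a..b} (\<lambda>s. F (s, y))"
    "(LINT s:{a..b}|lborel. F (x, s)) = integral {a..b} (\<lambda>s. F (x, s))" for a b
    by (rule set_borel_integral_eq_integral borel_integrable_atLeastAtMost' c)+
  note set = this[unfolded set_lebesgue_integral_def real_scaleR_def]
  have ind: "indicator unit_disk (x, y) = (indicator {-1..1} y * indicator {- sqrt (1 - y\<^sup>2)..sqrt (1 - y\<^sup>2)} x :: real)"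
    "indicator unit_disk (x, y) = (indicator {-1..1} x * indicator {- sqrt (1 - x\<^sup>2)..sqrt (1 - x\<^sup>2)} y :: real)" for x y
    by (simp_all only: indicator_def of_bool_conj[symmetric] flip: unit_disk_Pair_iff[of x y])
  show "(\<integral>x. indicator unit_disk (x, y) * F (x, y) \<partial>lborel) =
      indicator {-1..1} y * integral {- sqrt (1 - y\<^sup>2)..sqrt (1 - y\<^sup>2)} (\<lambda>x. F (x, y))"
    and "(\<integral>y. indicator unit_disk (x, y) * F (x, y) \<partial>lborel) =
      indicator {-1..1} x * integral {- sqrt (1 - x\<^sup>2)..sqrt (1 - x\<^sup>2)} (\<lambda>y. F (x, y))"
    by (simp_all only: ind(1)[of _ y] ind(2)[of x] mult.assoc integral_mult_right_zero set)
qed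

lemma integral_Icc_continuous:
  assumes "continuous_on {a..b::real} f"
  shows "(\<integral>y. indicator {a..b} y * f y \<partial>lborel) = integral {a..b} (f::real \<Rightarrow> real)"
    and "integrable lborel (\<lambda>y. indicator {a..b} y * f y)"
  using set_borel_integral_eq_integral(2)[OF borel_integrable_atLeastAtMost'[OF assms]]
    borel_integrable_atLeastAtMost'[OF assms]
  by (simp_all add: set_lebesgue_integral_def set_integrable_def)

text \<open>By the fundamental theorem of calculus on chords: horizontal chords give the first component
  and vertical chords the second. The factor \<open>x\<close>,
  which is the outward unit normal on the circle, comes from \<open>dy = cos \<theta> d\<theta>\<close> and
  \<open>dx = - sin \<theta> d\<theta>\<close>.\<close>

theorem Gauss_Green_disk:
  assumes f: "C1_gradient f G"
  shows "(\<integral>x. G x \<partial>disk_measure) = (\<integral>x. f x *\<^sub>R x \<partial>circle_measure)"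
proof -
  note cf = C1_gradient_continuous(1)[OF f] and cG = C1_gradient_continuous(2)[OF f]
  note arc = continuous_on_half_circles[OF cf]
  have c1: "continuous_on UNIV (\<lambda>x. fst (G x))" and c2: "continuous_on UNIV (\<lambda>x. snd (G x))"
    using cG by (auto intro!: continuous_intros)
  have ftc1: "integral {- sqrt (1 - y\<^sup>2)..sqrt (1 - y\<^sup>2)} (\<lambda>x. fst (G (x, y))) =
      f (sqrt (1 - y\<^sup>2), y) - f (- sqrt (1 - y\<^sup>2), y)"
    and ftc2: "integral {- sqrt (1 - y\<^sup>2)..sqrt (1 - y\<^sup>2)} (\<lambda>x. snd (G (y, x))) =
      f (y, sqrt (1 - y\<^sup>2)) - f (y, - sqrt (1 - y\<^sup>2))" if "y \<in> {-1..1}" for y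
  proof -
    have "y\<^sup>2 \<le> 1" using that by (auto simp: abs_square_le_1)
    then have le: "- sqrt (1 - y\<^sup>2) \<le> sqrt (1 - y\<^sup>2)" by simp
    show "integral {- sqrt (1 - y\<^sup>2)..sqrt (1 - y\<^sup>2)} (\<lambda>x. fst (G (x, y))) =
      f (sqrt (1 - y\<^sup>2), y) - f (- sqrt (1 - y\<^sup>2), y)"
      using C1_gradient_partial_derivatives(1)[OF f]
      by (intro integral_unique fundamental_theorem_of_calculus le)
        (simp add: has_real_derivative_iff_has_vector_derivative)
    show "integral {- sqrt (1 - y\<^sup>2)..sqrt (1 - y\<^sup>2)} (\<lambda>x. snd (G (y, x))) =
      f (y, sqrt (1 - y\<^sup>2)) - f (y, - sqrt (1 - y\<^sup>2))"
      using C1_gradient_partial_derivatives(2)[OF f]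
      by (intro integral_unique fundamental_theorem_of_calculus le)
        (simp add: has_real_derivative_iff_has_vector_derivative)
  qed
  have "(\<integral>x. fst (G x) \<partial>disk_measure) =
      (\<integral>y. indicator {-1..1} y * (f (sqrt (1 - y\<^sup>2), y) - f (- sqrt (1 - y\<^sup>2), y)) \<partial>lborel)"
    unfolding disk_Fubini(2)[OF c1] chord_integral(1)[OF c1]
    by (rule Bochner_Integration.integral_cong) (auto simp: indicator_def ftc1)
  also have "\<dots> = (\<integral>x. fst x * f x \<partial>circle_measure)"
    unfolding circle_integral_split[OF cf]
    by (subst integral_Icc_continuous) 
      (auto intro!: Henstock_Kurzweil_Integration.integral_diff integrable_continuous_real continuous_on_diff arc)
  finally have 1: "(\<integral>x. fst (G x) \<partial>disk_measure) = (\<integral>x. fst x * f x \<partial>circle_measure)" .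
  have "(\<integral>x. snd (G x) \<partial>disk_measure) =
      (\<integral>y. indicator {-1..1} y * (f (y, sqrt (1 - y\<^sup>2)) - f (y, - sqrt (1 - y\<^sup>2))) \<partial>lborel)"
    unfolding disk_Fubini(4)[OF c2] chord_integral(2)[OF c2]
    by (rule Bochner_Integration.integral_cong) (auto simp: indicator_def ftc2)
  also have "\<dots> = (\<integral>x. snd x * f x \<partial>circle_measure)"
    unfolding circle_integral_split[OF cf]
    by (subst integral_Icc_continuous) 
      (auto intro!: Henstock_Kurzweil_Integration.integral_diff integrable_continuous_real continuous_on_diff arc)
  finally have 2: "(\<integral>x. snd (G x) \<partial>disk_measure) = (\<integral>x. snd x * f x \<partial>circle_measure)" .
  have iG: "integrable disk_measure G"
    by (rule integrable_disk_continuous) (rule C1_gradient_continuous[OF f])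
  have ix: "integrable circle_measure (\<lambda>x. f x *\<^sub>R x)"
    by (rule integrable_circle_continuous) (intro continuous_intros C1_gradient_continuous[OF f])
  show ?thesis
    using 1 2 integral_fst[OF iG] integral_snd[OF iG] integral_fst[OF ix] integral_snd[OF ix]
    by (auto simp: prod_eq_iff mult.commute)
qed

lemma C1_gradient_mult:
  assumes "C1_gradient f F" "C1_gradient g G"
  shows "C1_gradient (\<lambda>x. f x * g x) (\<lambda>x. f x *\<^sub>R G x + g x *\<^sub>R F x)"
  using assms unfolding C1_gradient_def
  by (auto intro!: GDERIV_mult continuous_intros simp: C1_gradient_continuous[OF assms(1)] C1_gradient_continuous[OF assms(2)])

lemma C1_gradient_coordinates:
  "C1_gradient fst (\<lambda>x. (1, 0))" "C1_gradient snd (\<lambda>x. (0, 1))"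
  unfolding C1_gradient_def gderiv_def
  by (auto intro!: derivative_eq_intros simp: inner_prod_def)

text \<open>The divergence theorem for the field \<open>x \<mapsto> f(x) x\<close>: its divergence is the integrand on the
  right, and \<open>x\<close> is its own outward normal on the circle.\<close>

lemma radial_divergence_C1:
  assumes f: "C1_gradient f G"
  shows "(\<integral>x. f x \<partial>circle_measure) = (\<integral>x. 2 * f x + x \<bullet> G x \<partial>disk_measure)"
proof -
  note cf = C1_gradient_continuous(1)[OF f] and cG = C1_gradient_continuous(2)[OF f]
  let ?G1 = "\<lambda>x. fst x *\<^sub>R G x + f x *\<^sub>R (1, 0)" and ?G2 = "\<lambda>x. snd x *\<^sub>R G x + f x *\<^sub>R (0, 1)"
  have 1: "(\<integral>x. ?G1 x \<partial>disk_measure) = (\<integral>x. (fst x * f x) *\<^sub>R x \<partial>circle_measure)"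
    and 2: "(\<integral>x. ?G2 x \<partial>disk_measure) = (\<integral>x. (snd x * f x) *\<^sub>R x \<partial>circle_measure)"
    by (rule Gauss_Green_disk C1_gradient_mult C1_gradient_coordinates f)+
  have i: "integrable disk_measure ?G1" "integrable disk_measure ?G2"
    "integrable circle_measure (\<lambda>x. (fst x * f x) *\<^sub>R x)"
    "integrable circle_measure (\<lambda>x. (snd x * f x) *\<^sub>R x)"
    by (auto intro!: integrable_disk_continuous integrable_circle_continuous continuous_intros cf cG)
  have "(\<integral>x. 2 * f x + x \<bullet> G x \<partial>disk_measure) = (\<integral>x. fst (?G1 x) + snd (?G2 x) \<partial>disk_measure)"
    by (rule Bochner_Integration.integral_cong) (auto simp: inner_prod_def)
  also have "\<dots> = fst (\<integral>x. ?G1 x \<partial>disk_measure) + snd (\<integral>x. ?G2 x \<partial>disk_measure)"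
    by (subst Bochner_Integration.integral_add[OF integrable_fst[OF i(1)] integrable_snd[OF i(2)]])
      (simp only: integral_fst[OF i(1)] integral_snd[OF i(2)])
  also have "\<dots> = (\<integral>x. fst ((fst x * f x) *\<^sub>R x) + snd ((snd x * f x) *\<^sub>R x) \<partial>circle_measure)"
    unfolding 1 2
    by (subst Bochner_Integration.integral_add[OF integrable_fst[OF i(3)] integrable_snd[OF i(4)]])
      (simp only: integral_fst[OF i(3)] integral_snd[OF i(4)])
  also have "\<dots> = (\<integral>x. f x \<partial>circle_measure)"
  proof (rule Bochner_Integration.integral_cong)
    fix x :: "real \<times> real" assume "x \<in> space circle_measure"
    then have "(fst x)\<^sup>2 + (snd x)\<^sup>2 = 1"
      by (cases x) (simp add: norm_Pair real_sqrt_eq_1_iff)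
    then have "((fst x)\<^sup>2 + (snd x)\<^sup>2) * f x = f x" by simp
    then show "fst ((fst x * f x) *\<^sub>R x) + snd ((snd x * f x) *\<^sub>R x) = f x"
      by (simp add: power2_eq_square algebra_simps)
  qed simp
  finally show ?thesis by simp
qed

section \<open>Square-integrable functions\<close>

lemma L2_measurable: "L2 M f \<Longrightarrow> f \<in> borel_measurable M"
  and L2_integrable_norm_sq: "L2 M f \<Longrightarrow> integrable M (\<lambda>x. (norm (f x))\<^sup>2)"
  by (auto simp: L2_def)

lemma L2_norm:
  assumes "L2 M f"
  shows "L2 M (\<lambda>x. norm (f x))"
  using assms by (auto simp: L2_def)

lemma L2_bound:
  assumes "L2 M g" "f \<in> borel_measurable M" "\<And>x. x \<in> space M \<Longrightarrow> norm (f x) \<le> C * norm (g x)"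
  shows "L2 M f"
  unfolding L2_def
proof
  show "integrable M (\<lambda>x. (norm (f x))\<^sup>2)"
  proof (rule Bochner_Integration.integrable_bound)
    show "integrable M (\<lambda>x. C\<^sup>2 * (norm (g x))\<^sup>2)"
      using assms(1) by (auto simp: L2_def)
    show "AE x in M. norm ((norm (f x))\<^sup>2) \<le> norm (C\<^sup>2 * (norm (g x))\<^sup>2)"
      using power_mono[OF assms(3)] by (auto simp: power_mult_distrib abs_mult)
  qed (use assms(2) in measurable)
qed (fact assms)

lemma norm_add_sq_le: "(norm (a + b))\<^sup>2 \<le> 2 * (norm a)\<^sup>2 + 2 * (norm b)\<^sup>2"
  for a b :: "'a::real_normed_vector"
proof -
  have "(norm (a + b))\<^sup>2 \<le> (norm a + norm b)\<^sup>2"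
    by (intro power_mono norm_triangle_ineq) auto
  also have "\<dots> \<le> 2 * (norm a)\<^sup>2 + 2 * (norm b)\<^sup>2"
    using zero_le_power2[of "norm a - norm b"] by (simp add: power2_eq_square algebra_simps)
  finally show ?thesis .
qed

lemma L2_add:
  fixes f g :: "'a \<Rightarrow> 'b::euclidean_space"
  assumes f: "L2 M f" and g: "L2 M g"
  shows "L2 M (\<lambda>x. f x + g x)"
  unfolding L2_def
proof
  have [measurable]: "f \<in> borel_measurable M" "g \<in> borel_measurable M"
    using assms by (auto simp: L2_def)
  show "(\<lambda>x. f x + g x) \<in> borel_measurable M" by measurable
  show "integrable M (\<lambda>x. (norm (f x + g x))\<^sup>2)"
  proof (rule Bochner_Integration.integrable_bound)
    show "integrable M (\<lambda>x. 2 * (norm (f x))\<^sup>2 + 2 * (norm (g x))\<^sup>2)"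
      using assms by (auto simp: L2_def)
    show "AE x in M. norm ((norm (f x + g x))\<^sup>2) \<le> norm (2 * (norm (f x))\<^sup>2 + 2 * (norm (g x))\<^sup>2)"
      by (simp add: norm_add_sq_le)
  qed measurable
qed

lemma L2_scaleR:
  assumes "L2 M f"
  shows "L2 M (\<lambda>x. c *\<^sub>R f x)"
  by (rule L2_bound[OF assms, of _ "\<bar>c\<bar>"]) (use assms in \<open>auto simp: L2_def\<close>)

lemma L2_diff:
  fixes f g :: "'a \<Rightarrow> 'b::euclidean_space"
  assumes f: "L2 M f" and g: "L2 M g"
  shows "L2 M (\<lambda>x. f x - g x)"
  using L2_add[OF f L2_scaleR[OF g, of "-1"]] by simp

lemma (in finite_measure) L2_bounded:
  assumes "f \<in> borel_measurable M" "\<And>x. x \<in> space M \<Longrightarrow> norm (f x) \<le> C"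
  shows "L2 M f"
  by (rule L2_bound[of M "\<lambda>x. C::real", OF _ assms(1), of 1])
    (use assms(2) in \<open>force simp: L2_def\<close>)+

lemma L2_integrable_mult:
  fixes f g :: "'a \<Rightarrow> real"
  assumes "L2 M f" "L2 M g"
  shows "integrable M (\<lambda>x. f x * g x)"
proof (rule Bochner_Integration.integrable_bound)
  have [measurable]: "f \<in> borel_measurable M" "g \<in> borel_measurable M"
    using assms by (auto simp: L2_def)
  show "integrable M (\<lambda>x. (f x)\<^sup>2 + (g x)\<^sup>2)"
    using assms by (auto simp: L2_def)
  have "\<bar>f x * g x\<bar> \<le> (f x)\<^sup>2 + (g x)\<^sup>2" for x
    using zero_le_power2[of "\<bar>f x\<bar> - \<bar>g x\<bar>"] mult_nonneg_nonneg[OF abs_ge_zero[of "f x"] abs_ge_zero[of "g x"]]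
    unfolding power2_diff abs_mult power2_abs by linarith
  then show "AE x in M. norm (f x * g x) \<le> norm ((f x)\<^sup>2 + (g x)\<^sup>2)"
    by auto
  show "(\<lambda>x. f x * g x) \<in> borel_measurable M" by measurable
qed

lemma (in finite_measure) L2_integrable:
  assumes "L2 M f"
  shows "integrable M f"
proof (rule Bochner_Integration.integrable_bound)
  show "integrable M (\<lambda>x. norm (f x) * 1)"
    by (rule L2_integrable_mult[OF L2_norm[OF assms] L2_bounded[of _ 1]]) auto
qed (use assms in \<open>auto simp: L2_def\<close>)

lemma integral_Cauchy_Schwarz:
  fixes f g :: "'a \<Rightarrow> real"
  assumes f: "L2 M f" and g: "L2 M g"
  shows "(\<integral>x. f x * g x \<partial>M)\<^sup>2 \<le> (\<integral>x. (f x)\<^sup>2 \<partial>M) * (\<integral>x. (g x)\<^sup>2 \<partial>M)"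
proof -
  define a b c where "a = (\<integral>x. (f x)\<^sup>2 \<partial>M)" and "b = (\<integral>x. f x * g x \<partial>M)" and "c = (\<integral>x. (g x)\<^sup>2 \<partial>M)"
  have i: "integrable M (\<lambda>x. (f x)\<^sup>2)" "integrable M (\<lambda>x. (g x)\<^sup>2)" "integrable M (\<lambda>x. f x * g x)"
    using L2_integrable_norm_sq[OF f] L2_integrable_norm_sq[OF g] L2_integrable_mult[OF f g] by auto
  have q: "0 \<le> c * t\<^sup>2 + (- 2 * b) * t + a" for t
  proof -
    have "0 \<le> (\<integral>x. (t * g x - f x)\<^sup>2 \<partial>M)" by simp
    also have "(\<integral>x. (t * g x - f x)\<^sup>2 \<partial>M) = (\<integral>x. t\<^sup>2 * (g x)\<^sup>2 - (2 * t) * (f x * g x) + (f x)\<^sup>2 \<partial>M)"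
      by (rule Bochner_Integration.integral_cong) (auto simp: power2_eq_square algebra_simps)
    also have "\<dots> = c * t\<^sup>2 + (- 2 * b) * t + a"
      using i by (simp add: a_def b_def c_def)
    finally show ?thesis .
  qed
  have "c \<ge> 0" "a \<ge> 0" by (simp_all add: c_def a_def)
  have "b\<^sup>2 \<le> a * c"
  proof (cases "c = 0")
    case True
    have "b = 0"
    proof (rule ccontr)
      assume "b \<noteq> 0"
      with q[of "(a + 1) / (2 * b)"] True show False by (simp add: field_simps)
    qed
    with True show ?thesis by simp
  next
    case False
    have "0 \<le> c * (c * (b/c)\<^sup>2 + (- 2 * b) * (b/c) + a)"
      by (rule mult_nonneg_nonneg[OF \<open>c \<ge> 0\<close> q])
    also have "\<dots> = a * c - b\<^sup>2"
      using False by (simp add: field_simps power2_eq_square)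
    finally show ?thesis by simp
  qed
  then show ?thesis by (simp add: a_def b_def c_def)
qed

lemma L2_converges_imp_L2: "L2_converges M F f \<Longrightarrow> L2 M (F n)" "L2_converges M F f \<Longrightarrow> L2 M f"
  by (auto simp: L2_converges_def)

lemma L2_converges_tendsto:
  "L2_converges M F f \<Longrightarrow> (\<lambda>n. \<integral>x. (norm (F n x - f x))\<^sup>2 \<partial>M) \<longlonglongrightarrow> 0"
  by (auto simp: L2_converges_def)

lemma L2_converges_subseq:
  assumes "L2_converges M F f" "strict_mono r"
  shows "L2_converges M (\<lambda>n. F (r n)) f"
  using assms LIMSEQ_subseq_LIMSEQ[OF L2_converges_tendsto[OF assms(1)] assms(2)]
  by (auto simp: L2_converges_def o_def)

lemma L2_converges_AE_subseq:
  assumes "L2_converges M F f"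
  shows "\<exists>r::nat \<Rightarrow> nat. strict_mono r \<and> (AE x in M. (\<lambda>n. F (r n) x) \<longlonglongrightarrow> f x)"
proof -
  have "\<exists>r::nat\<Rightarrow>nat. strict_mono r \<and> (AE x in M. (\<lambda>n. (norm (F (r n) x - f x))\<^sup>2) \<longlonglongrightarrow> 0)"
  proof (rule tendsto_L1_AE_subseq)
    show "integrable M (\<lambda>x. (norm (F n x - f x))\<^sup>2)" for n
      by (rule L2_integrable_norm_sq[OF L2_diff]) (rule L2_converges_imp_L2[OF assms])+
    show "(\<lambda>n. \<integral>x. norm ((norm (F n x - f x))\<^sup>2) \<partial>M) \<longlonglongrightarrow> 0"
      using L2_converges_tendsto[OF assms] by simp
  qed
  then obtain r :: "nat \<Rightarrow> nat" where r: "strict_mono r"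
    and ae: "AE x in M. (\<lambda>n. (norm (F (r n) x - f x))\<^sup>2) \<longlonglongrightarrow> 0" by blast
  have "AE x in M. (\<lambda>n. F (r n) x) \<longlonglongrightarrow> f x"
    using ae
  proof eventually_elim
    fix x assume "(\<lambda>n. (norm (F (r n) x - f x))\<^sup>2) \<longlonglongrightarrow> 0"
    then have "(\<lambda>n. sqrt ((norm (F (r n) x - f x))\<^sup>2)) \<longlonglongrightarrow> sqrt 0"
      by (rule tendsto_real_sqrt)
    then have "(\<lambda>n. norm (F (r n) x - f x)) \<longlonglongrightarrow> 0"
      by simp
    then show "(\<lambda>n. F (r n) x) \<longlonglongrightarrow> f x"
      by (metis LIM_zero_cancel tendsto_norm_zero_iff)
  qed
  with r show ?thesis by blast
qed

lemma L2_converges_integral_product: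
  fixes f :: "'a \<Rightarrow> 'b::euclidean_space" and w :: "'a \<Rightarrow> 'c::euclidean_space"
    and prod :: "'c \<Rightarrow> 'b \<Rightarrow> 'd::euclidean_space"
  assumes prod: "bounded_bilinear prod" and M: "finite_measure M"
    and F: "L2_converges M F f" and w: "w \<in> borel_measurable M"
    and bound: "\<And>x. x \<in> space M \<Longrightarrow> norm (w x) \<le> C"
  shows "(\<lambda>n. \<integral>x. prod (w x) (F n x) \<partial>M) \<longlonglongrightarrow> (\<integral>x. prod (w x) (f x) \<partial>M)"
proof -
  interpret finite_measure M by (rule M)
  interpret prod: bounded_bilinear prod by (rule prod)
  note FL = L2_converges_imp_L2(1)[OF F] and fL = L2_converges_imp_L2(2)[OF F]
  obtain K where K: "\<And>a b. norm (prod a b) \<le> norm a * norm b * K" and "0 \<le> K"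
    using prod.nonneg_bounded by blast
  have le: "norm (prod (w x) y) \<le> K * C * norm y" if "x \<in> space M" for x y
  proof -
    have "norm (w x) * norm y * K \<le> C * norm y * K"
      using bound[OF that] \<open>0 \<le> K\<close> by (intro mult_right_mono) auto
    with K[of "w x" y] show ?thesis by (simp add: ac_simps)
  qed
  have m: "(\<lambda>x. prod (w x) (h x)) \<in> borel_measurable M" if "L2 M h" for h
    by (rule borel_measurable_continuous_Pair[OF w L2_measurable[OF that]])
      (intro prod.continuous_on continuous_intros)
  have i: "integrable M (\<lambda>x. prod (w x) (h x))" if "L2 M h" for h
    by (rule L2_integrable[OF L2_bound[OF that m[OF that]]]) (rule le)
  let ?W = "\<integral>x. (K * C)\<^sup>2 \<partial>M"
  have b: "norm ((\<integral>x. prod (w x) (F n x) \<partial>M) - (\<integral>x. prod (w x) (f x) \<partial>M)) \<le>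
      sqrt (?W * (\<integral>x. (norm (F n x - f x))\<^sup>2 \<partial>M))" for n
  proof -
    have d: "L2 M (\<lambda>x. F n x - f x)" by (rule L2_diff[OF FL fL])
    have KC: "L2 M (\<lambda>x. K * C)" by (rule L2_bounded) auto
    have "(\<integral>x. prod (w x) (F n x) \<partial>M) - (\<integral>x. prod (w x) (f x) \<partial>M) = (\<integral>x. prod (w x) (F n x - f x) \<partial>M)"
      using i[OF FL] i[OF fL] by (simp add: prod.diff_right)
    also have "norm \<dots> \<le> (\<integral>x. norm (prod (w x) (F n x - f x)) \<partial>M)"
      by (rule integral_norm_bound)
    also have "\<dots> \<le> (\<integral>x. (K * C) * norm (F n x - f x) \<partial>M)"
      by (intro integral_mono integrable_norm i[OF d] L2_integrable_mult[OF KC L2_norm[OF d]] le)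
    also have "\<dots> \<le> sqrt (?W * (\<integral>x. (norm (F n x - f x))\<^sup>2 \<partial>M))"
      by (rule real_le_rsqrt) (rule integral_Cauchy_Schwarz[OF KC L2_norm[OF d]])
    finally show ?thesis .
  qed
  have "(\<lambda>n. sqrt (?W * (\<integral>x. (norm (F n x - f x))\<^sup>2 \<partial>M))) \<longlonglongrightarrow> 0"
    using tendsto_real_sqrt[OF tendsto_mult_left[OF L2_converges_tendsto[OF F], of ?W]] by simp
  then have "(\<lambda>n. (\<integral>x. prod (w x) (F n x) \<partial>M) - (\<integral>x. prod (w x) (f x) \<partial>M)) \<longlonglongrightarrow> 0"
    by (rule Lim_null_comparison[rotated]) (use b in \<open>auto intro!: always_eventually\<close>)
  then show ?thesis by (rule LIM_zero_cancel)
qed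

text \<open>Fatou's lemma, as a criterion for integrability.\<close>

lemma integrable_Fatou:
  fixes f :: "'a \<Rightarrow> real"
  assumes f: "f \<in> borel_measurable M" and fn: "\<And>n. integrable M (F n)"
    and nn: "\<And>n x. 0 \<le> F n x" and ae: "AE x in M. (\<lambda>n. F n x) \<longlonglongrightarrow> f x"
    and le: "eventually (\<lambda>n. (\<integral>x. F n x \<partial>M) \<le> C) sequentially"
  shows "integrable M f"
proof (rule integrableI_nonneg[OF f])
  show "AE x in M. 0 \<le> f x"
    using ae by eventually_elim (rule LIMSEQ_le_const, auto simp: nn)
  have "(\<integral>\<^sup>+x. ennreal (f x) \<partial>M) = (\<integral>\<^sup>+x. liminf (\<lambda>n. ennreal (F n x)) \<partial>M)"
    using ae by (intro nn_integral_cong_AE, eventually_elim)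
      (metis lim_imp_Liminf sequentially_bot tendsto_ennrealI)
  also have "\<dots> \<le> liminf (\<lambda>n. \<integral>\<^sup>+x. ennreal (F n x) \<partial>M)"
    by (rule nn_integral_liminf) (use fn in auto)
  also have "\<dots> \<le> ennreal C"
  proof (rule Liminf_le, simp)
    show "eventually (\<lambda>n. (\<integral>\<^sup>+x. ennreal (F n x) \<partial>M) \<le> ennreal C) sequentially"
      using le
    proof eventually_elim
      case (elim n)
      have "(\<integral>\<^sup>+x. ennreal (F n x) \<partial>M) = ennreal (\<integral>x. F n x \<partial>M)"
        by (rule nn_integral_eq_integral[OF fn]) (simp add: nn)
      with elim show ?case by (simp add: ennreal_leI)
    qed
  qed
  finally show "(\<integral>\<^sup>+x. ennreal (f x) \<partial>M) < \<infinity>"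
    by (rule le_less_trans) simp
qed

section \<open>Exponential integrability of Sobolev functions and their traces\<close>

text \<open>Gagliardo--Nirenberg for \<open>W\<^bsup>1,1\<^esup>\<close> of the disk. Each value of \<open>f\<close> is at most its
  value at the right end of the horizontal chord plus the integral of \<open>|\<nabla>f|\<close> over that chord, a
  function of \<open>y\<close> alone; likewise with vertical chords and a function of \<open>x\<close> alone. The product of
  the two bounds integrates by Fubini. Starting from the circle rather than from an average over the
  chord avoids a bad constant near the poles, where the chords are short.\<close>

lemma Gagliardo_Nirenberg_disk:
  assumes f: "C1_gradient f G" and pos: "\<And>x. 0 \<le> f x"
  shows "(\<integral>x. (f x)\<^sup>2 \<partial>disk_measure) \<le>
    ((\<integral>x. f x \<partial>circle_measure) + (\<integral>x. norm (G x) \<partial>disk_measure))\<^sup>2"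
proof -
  note cf = C1_gradient_continuous(1)[OF f] and cG = C1_gradient_continuous(2)[OF f]
  let ?g = "\<lambda>x. norm (G x)"
  have cg: "continuous_on UNIV ?g" by (intro continuous_intros cG)
  have cf2: "continuous_on UNIV (\<lambda>x. (f x)\<^sup>2)" by (intro continuous_intros cf)
  note arc = continuous_on_half_circles[OF cf]
  define S where "S = (\<integral>x. f x \<partial>circle_measure) + (\<integral>x. ?g x \<partial>disk_measure)"
  define A where "A y = indicator {-1..1} y * f (sqrt (1 - y\<^sup>2), y) +
      (\<integral>x. indicator unit_disk (x, y) * ?g (x, y) \<partial>lborel)" for y
  define B where "B x = indicator {-1..1} x * f (x, sqrt (1 - x\<^sup>2)) +
      (\<integral>y. indicator unit_disk (x, y) * ?g (x, y) \<partial>lborel)" for x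
  have iA: "integrable lborel A" and iB: "integrable lborel B"
    unfolding A_def B_def
    by (intro Bochner_Integration.integrable_add integral_Icc_continuous(2) arc disk_Fubini[OF cg])+
  have nA: "0 \<le> A y" and nB: "0 \<le> B y" for y
    by (auto simp: A_def B_def pos intro!: add_nonneg_nonneg mult_nonneg_nonneg)
  have "(\<integral>y. A y \<partial>lborel) = integral {-1..1} (\<lambda>y. f (sqrt (1 - y\<^sup>2), y)) + (\<integral>x. ?g x \<partial>disk_measure)"
    unfolding A_def
    by (simp add: integral_Icc_continuous[OF arc(1)] disk_Fubini(1)[OF cg] disk_Fubini(2)[OF cg])
  then have AS: "(\<integral>y. A y \<partial>lborel) \<le> S"
    using arc_integral_le(1)[OF cf pos] by (simp add: S_def)
  have "(\<integral>y. B y \<partial>lborel) = integral {-1..1} (\<lambda>y. f (y, sqrt (1 - y\<^sup>2))) + (\<integral>x. ?g x \<partial>disk_measure)"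
    unfolding B_def
    by (simp add: integral_Icc_continuous[OF arc(3)] disk_Fubini(3)[OF cg] disk_Fubini(4)[OF cg])
  then have BS: "(\<integral>y. B y \<partial>lborel) \<le> S"
    using arc_integral_le(2)[OF cf pos] by (simp add: S_def)
  \<comment> \<open>The one-dimensional bound by the value at the right end of an interval.\<close>
  have chord: "\<phi> x \<le> \<phi> b + integral {a..b} n"
    if x: "x \<in> {a..b}" and d: "\<And>s. (\<phi> has_real_derivative \<phi>' s) (at s)"
      and n: "continuous_on UNIV n" "\<And>s. \<bar>\<phi>' s\<bar> \<le> n s" for \<phi> \<phi>' n :: "real \<Rightarrow> real" and a b x
  proof -
    have ftc: "(\<phi>' has_integral (\<phi> b - \<phi> x)) {x..b}"
      using x d by (intro fundamental_theorem_of_calculus)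
        (auto simp: has_real_derivative_iff_has_vector_derivative intro: has_vector_derivative_at_within)
    have ni: "n integrable_on {c..d}" for c d
      by (intro integrable_continuous_real continuous_on_subset[OF n(1)]) simp
    have nn: "0 \<le> n s" for s using n(2)[of s] by linarith
    have "- (\<phi> b - \<phi> x) \<le> integral {x..b} n"
      by (rule has_integral_le[OF has_integral_neg[OF ftc] integrable_integral[OF ni]])
        (use n(2) in \<open>auto simp: abs_le_iff\<close>)
    also have "\<dots> \<le> integral {a..b} n"
      using x nn by (intro integral_subset_le ni) auto
    finally show ?thesis by simp
  qed
  have norm_ge: "\<bar>fst v\<bar> \<le> norm v" "\<bar>snd v\<bar> \<le> norm v" for v :: "real \<times> real"
    using norm_fst_le[of "fst v" "snd v"] norm_snd_le[of "snd v" "fst v"] by simp_all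
  have fA: "f (x, y) \<le> A y" if "(x, y) \<in> unit_disk" for x y
  proof -
    have "f (x, y) \<le> f (sqrt (1 - y\<^sup>2), y) + integral {- sqrt (1 - y\<^sup>2)..sqrt (1 - y\<^sup>2)} (\<lambda>s. ?g (s, y))"
      using that unfolding unit_disk_Pair_iff(1)[of x y]
      by (intro chord[where \<phi>="\<lambda>s. f (s, y)" and \<phi>'="\<lambda>s. fst (G (s, y))"] norm_ge
          C1_gradient_partial_derivatives(1)[OF f] continuous_intros continuous_on_compose2[OF cG]) auto
    then show ?thesis
      using that unfolding A_def chord_integral(1)[OF cg] unit_disk_Pair_iff(1)[of x y] by simp
  qed
  have fB: "f (x, y) \<le> B x" if "(x, y) \<in> unit_disk" for x y
  proof -
    have "f (x, y) \<le> f (x, sqrt (1 - x\<^sup>2)) + integral {- sqrt (1 - x\<^sup>2)..sqrt (1 - x\<^sup>2)} (\<lambda>s. ?g (x, s))"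
      using that unfolding unit_disk_Pair_iff(2)[of x y]
      by (intro chord[where \<phi>="\<lambda>s. f (x, s)" and \<phi>'="\<lambda>s. snd (G (x, s))"] norm_ge
          C1_gradient_partial_derivatives(2)[OF f] continuous_intros continuous_on_compose2[OF cG]) auto
    then show ?thesis
      using that unfolding B_def chord_integral(2)[OF cg] unit_disk_Pair_iff(2)[of x y] by simp
  qed
  have "(\<integral>x. (f x)\<^sup>2 \<partial>disk_measure) = (\<integral>y. \<integral>x. indicator unit_disk (x, y) * (f (x, y))\<^sup>2 \<partial>lborel \<partial>lborel)"
    by (rule disk_Fubini(2)[OF cf2])
  also have "\<dots> \<le> (\<integral>y. \<integral>x. A y * B x \<partial>lborel \<partial>lborel)"
  proof (rule integral_mono')
    show "integrable lborel (\<lambda>y. \<integral>x. A y * B x \<partial>lborel)" using iA by simp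
    show "(\<integral>x. indicator unit_disk (x, y) * (f (x, y))\<^sup>2 \<partial>lborel) \<le> (\<integral>x. A y * B x \<partial>lborel)" for y
    proof (rule integral_mono')
      show "integrable lborel (\<lambda>x. A y * B x)" using iB by simp
      show "indicator unit_disk (x, y) * (f (x, y))\<^sup>2 \<le> A y * B x" for x
        using mult_mono[OF fA fB, of x y x y] pos nA nB
        by (cases "(x, y) \<in> unit_disk") (auto simp: power2_eq_square)
    qed (simp add: nA nB)
    show "0 \<le> (\<integral>x. A y * B x \<partial>lborel)" for y
      by (simp add: nA nB)
  qed
  also have "\<dots> = (\<integral>y. A y \<partial>lborel) * (\<integral>x. B x \<partial>lborel)" by simp
  also have "\<dots> \<le> S * S"
    by (intro mult_mono AS BS order_trans[OF _ AS] order_trans[OF _ BS] integral_nonneg_AE)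
      (auto simp: nA nB)
  finally show ?thesis by (simp add: S_def power2_eq_square)
qed

lemma C1_gradient_exp:
  assumes "C1_gradient v V"
  shows "C1_gradient (\<lambda>x. exp (v x)) (\<lambda>x. exp (v x) *\<^sub>R V x)"
  unfolding C1_gradient_def
proof (intro conjI allI)
  show "GDERIV (\<lambda>x. exp (v x)) x :> exp (v x) *\<^sub>R V x" for x
    using assms unfolding C1_gradient_def by (intro GDERIV_DERIV_compose DERIV_exp) blast
qed (intro continuous_intros C1_gradient_continuous[OF assms])

lemma C1_gradient_scale_diff:
  assumes "C1_gradient f F" "C1_gradient g G"
  shows "C1_gradient (\<lambda>x. c * (f x - g x)) (\<lambda>x. c *\<^sub>R (F x - G x))"
  using assms unfolding C1_gradient_def gderiv_def
  by (auto intro!: continuous_intros derivative_eq_intros simp: inner_diff_right)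

text \<open>Exponentials of functions of small \<open>H\<^sup>1\<close> norm, by absorption: for \<open>f = e\<^sup>v\<close>
  the elementary \<open>e\<^sup>v \<le> e + |v| e\<^sup>v\<close> and Cauchy--Schwarz bound the right-hand side
  of the Gagliardo--Nirenberg inequality by a constant plus a small multiple of its left-hand side.\<close>

lemma exp_integral_bound:
  assumes v: "C1_gradient v V"
    and small: "(\<integral>x. (v x)\<^sup>2 + (norm (V x))\<^sup>2 \<partial>disk_measure) \<le> 1/32"
  defines "m \<equiv> exp 1 * measure disk_measure unit_disk"
  shows "(\<integral>x. exp (2 * v x) \<partial>disk_measure) \<le> (4 * m)\<^sup>2"
    and "(\<integral>x. exp (v x) \<partial>circle_measure) \<le> 4 * m"
proof -
  note f = C1_gradient_exp[OF v]
  note cv = C1_gradient_continuous(1)[OF v] and cV = C1_gradient_continuous(2)[OF v]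
  note i = integrable_disk_continuous integrable_circle_continuous
  let ?f = "\<lambda>x. exp (v x)"
  let ?w = "\<lambda>x. \<bar>v x\<bar> + norm (V x)"
  \<comment> \<open>\<open>2 R\<close> bounds the sum of the two integrals on the right of the Gagliardo--Nirenberg inequality.\<close>
  define R where "R = (\<integral>x. ?f x + norm (V x) * ?f x \<partial>disk_measure)"
  define A where "A = (\<integral>x. (?f x)\<^sup>2 \<partial>disk_measure)"
  define I where "I = (\<integral>x. ?w x * ?f x \<partial>disk_measure)"
  have "(\<integral>x. ?f x \<partial>circle_measure) = (\<integral>x. 2 * ?f x + x \<bullet> (?f x *\<^sub>R V x) \<partial>disk_measure)"
    by (rule radial_divergence_C1[OF f])
  also have "\<dots> \<le> (\<integral>x. 2 * ?f x + norm (V x) * ?f x \<partial>disk_measure)"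
  proof (intro integral_mono i continuous_intros cv cV)
    fix x :: "real \<times> real" assume "x \<in> space disk_measure"
    then have "x \<bullet> V x \<le> 1 * norm (V x)"
      by (intro order_trans[OF norm_cauchy_schwarz] mult_right_mono) auto
    then show "2 * ?f x + x \<bullet> (?f x *\<^sub>R V x) \<le> 2 * ?f x + norm (V x) * ?f x"
      by (simp add: mult.commute)
  qed
  finally have circ: "(\<integral>x. ?f x \<partial>circle_measure) \<le> (\<integral>x. 2 * ?f x + norm (V x) * ?f x \<partial>disk_measure)" .
  have "(\<integral>x. 2 * ?f x + norm (V x) * ?f x \<partial>disk_measure) + (\<integral>x. norm (?f x *\<^sub>R V x) \<partial>disk_measure) =
    (\<integral>x. (2 * ?f x + norm (V x) * ?f x) + norm (?f x *\<^sub>R V x) \<partial>disk_measure)"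
    by (intro Bochner_Integration.integral_add[symmetric] i continuous_intros cv cV)
  also have "\<dots> = (\<integral>x. 2 * (?f x + norm (V x) * ?f x) \<partial>disk_measure)"
    by (rule Bochner_Integration.integral_cong) (auto simp: algebra_simps)
  also have "\<dots> = 2 * R" unfolding R_def by (rule integral_mult_right_zero)
  finally have tot: "(\<integral>x. 2 * ?f x + norm (V x) * ?f x \<partial>disk_measure) + (\<integral>x. norm (?f x *\<^sub>R V x) \<partial>disk_measure) = 2 * R" .
  have circ2: "(\<integral>x. ?f x \<partial>circle_measure) \<le> 2 * R"
    using circ tot Bochner_Integration.integral_nonneg[of disk_measure "\<lambda>x. norm (?f x *\<^sub>R V x)", OF norm_ge_zero]
    by linarith
  have "A \<le> ((\<integral>x. ?f x \<partial>circle_measure) + (\<integral>x. norm (?f x *\<^sub>R V x) \<partial>disk_measure))\<^sup>2"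
    unfolding A_def by (rule Gagliardo_Nirenberg_disk[OF f]) simp
  also have "\<dots> \<le> (2 * R)\<^sup>2"
    using circ tot by (intro power_mono) (auto intro!: add_nonneg_nonneg)
  finally have AR: "A \<le> (2 * R)\<^sup>2" .
  have "R \<le> (\<integral>x. exp 1 + ?w x * ?f x \<partial>disk_measure)"
    unfolding R_def
  proof (intro integral_mono i continuous_intros cv cV)
    fix x :: "real \<times> real"
    have "?f x \<le> exp 1 + \<bar>v x\<bar> * ?f x"
    proof (cases "v x \<le> 1")
      case True then show ?thesis by (simp add: add_increasing2)
    next
      case False
      then have "1 * ?f x \<le> \<bar>v x\<bar> * ?f x" by (intro mult_right_mono) auto
      then show ?thesis using exp_ge_zero[of "1::real"] by linarith
    qed
    then show "?f x + norm (V x) * ?f x \<le> exp 1 + ?w x * ?f x" by (simp add: algebra_simps)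
  qed
  also have "\<dots> = m + I"
    unfolding I_def m_def
    by (subst Bochner_Integration.integral_add) (auto intro!: i continuous_intros cv cV)
  finally have RI: "R \<le> m + I" .
  have L2c: "L2 disk_measure h" if "continuous_on UNIV h" for h :: "real \<times> real \<Rightarrow> real"
    unfolding L2_def
    by (auto intro!: i measurable_disk_continuous continuous_intros continuous_on_subset[OF that])
  have "I\<^sup>2 \<le> (\<integral>x. (?w x)\<^sup>2 \<partial>disk_measure) * A"
    unfolding I_def A_def
    by (intro integral_Cauchy_Schwarz L2c continuous_intros cv cV)
  also have "(\<integral>x. (?w x)\<^sup>2 \<partial>disk_measure) \<le> (\<integral>x. 2 * ((v x)\<^sup>2 + (norm (V x))\<^sup>2) \<partial>disk_measure)"
  proof (intro integral_mono i continuous_intros cv cV)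
    fix x :: "real \<times> real"
    show "(?w x)\<^sup>2 \<le> 2 * ((v x)\<^sup>2 + (norm (V x))\<^sup>2)"
      using zero_le_power2[of "\<bar>v x\<bar> - norm (V x)"] by (simp add: power2_diff power2_sum)
  qed
  also have "\<dots> \<le> 1/16"
    using small by (subst integral_mult_right_zero) linarith
  finally have "I\<^sup>2 \<le> 1/16 * A" by (simp add: mult_right_mono A_def)
  moreover have "0 \<le> R" "0 \<le> m" by (simp_all add: R_def m_def)
  moreover have "R\<^sup>2 \<le> (m + I)\<^sup>2" by (rule power_mono[OF RI \<open>0 \<le> R\<close>])
  moreover have "(m + I)\<^sup>2 \<le> 2 * m\<^sup>2 + 2 * I\<^sup>2"
    using zero_le_power2[of "m - I"] by (simp add: power2_diff power2_sum)
  ultimately have "A \<le> 16 * m\<^sup>2" "(2 * R)\<^sup>2 \<le> (4 * m)\<^sup>2"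
    using AR by (simp_all add: power_mult_distrib)
  moreover have "A = (\<integral>x. exp (2 * v x) \<partial>disk_measure)"
    by (simp add: A_def exp_double)
  ultimately show "(\<integral>x. exp (2 * v x) \<partial>disk_measure) \<le> (4 * m)\<^sup>2"
    by (simp add: power_mult_distrib)
  have "2 * R \<le> 4 * m"
    by (rule power2_le_imp_le[OF \<open>(2 * R)\<^sup>2 \<le> (4 * m)\<^sup>2\<close>]) (simp add: \<open>0 \<le> m\<close>)
  with circ2 show "(\<integral>x. ?f x \<partial>circle_measure) \<le> 4 * m" by linarith
qed

lemma H1_trace_imp_L2:
  assumes "H1_trace u g \<tau>"
  shows "L2 disk_measure u" "L2 disk_measure g" "L2 circle_measure \<tau>"
  using assms by (auto simp: H1_trace_def H1_disk_def L2_converges_def)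

lemma H1_trace_AE_approximation:
  assumes "H1_trace u g \<tau>"
  obtains F G where "\<And>n. C1_gradient (F n) (G n)"
    "L2_converges disk_measure F u" "L2_converges disk_measure G g" "L2_converges circle_measure F \<tau>"
    "AE x in disk_measure. (\<lambda>n. F n x) \<longlonglongrightarrow> u x" "AE x in circle_measure. (\<lambda>n. F n x) \<longlonglongrightarrow> \<tau> x"
proof -
  obtain F G where C1: "\<And>n. C1_gradient (F n) (G n)" and Fu: "L2_converges disk_measure F u"
    and Gg: "L2_converges disk_measure G g" and Ft: "L2_converges circle_measure F \<tau>"
    using assms by (auto simp: H1_trace_def)
  obtain r :: "nat \<Rightarrow> nat" where r: "strict_mono r" and ae1: "AE x in disk_measure. (\<lambda>n. F (r n) x) \<longlonglongrightarrow> u x"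
    using L2_converges_AE_subseq[OF Fu] by blast
  obtain s :: "nat \<Rightarrow> nat" where s: "strict_mono s" and ae2: "AE x in circle_measure. (\<lambda>n. F (r (s n)) x) \<longlonglongrightarrow> \<tau> x"
    using L2_converges_AE_subseq[OF L2_converges_subseq[OF Ft r]] by blast
  have rs: "strict_mono (\<lambda>n. r (s n))"
    using r s by (simp add: strict_mono_def)
  have ae3: "AE x in disk_measure. (\<lambda>n. F (r (s n)) x) \<longlonglongrightarrow> u x"
    using ae1 by eventually_elim (drule LIMSEQ_subseq_LIMSEQ[OF _ s], simp add: o_def)
  show ?thesis
    by (rule that[of "\<lambda>n. F (r (s n))" "\<lambda>n. G (r (s n))"])
      (intro C1 L2_converges_subseq[OF _ rs] Fu Gg Ft ae2 ae3)+
qed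

text \<open>An \<open>H\<^sup>1\<close> function is a bounded function plus one of arbitrarily small norm, so the
  preceding bound applies to it after all, whatever the exponent.\<close>

lemma H1_exp_integrable:
  assumes H: "H1_trace u g \<tau>"
  shows "integrable disk_measure (\<lambda>x. exp (2 * p * u x))"
    and "integrable circle_measure (\<lambda>x. exp (p * \<tau> x))"
proof -
  obtain F G where C1: "\<And>n. C1_gradient (F n) (G n)" and Fu: "L2_converges disk_measure F u"
    and Gg: "L2_converges disk_measure G g" and Ft: "L2_converges circle_measure F \<tau>"
    and ae: "AE x in disk_measure. (\<lambda>n. F n x) \<longlonglongrightarrow> u x" "AE x in circle_measure. (\<lambda>n. F n x) \<longlonglongrightarrow> \<tau> x"
    by (rule H1_trace_AE_approximation[OF H]) (blast intro: that)
  note cont = C1_gradient_continuous[OF C1]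
  note i = integrable_disk_continuous integrable_circle_continuous
  have near: "(\<integral>x. (norm (f n x - f N x))\<^sup>2 \<partial>disk_measure) \<le> 4 * d"
    if f: "L2_converges disk_measure f h" and
      n: "(\<integral>x. (norm (f n x - h x))\<^sup>2 \<partial>disk_measure) \<le> d" and
      N: "(\<integral>x. (norm (f N x - h x))\<^sup>2 \<partial>disk_measure) \<le> d"
    for f :: "nat \<Rightarrow> real \<times> real \<Rightarrow> 'b::euclidean_space" and h n N d
  proof -
    note L = L2_converges_imp_L2[OF f]
    have I: "integrable disk_measure (\<lambda>x. (norm (f n x - h x))\<^sup>2)" for n
      by (intro L2_integrable_norm_sq L2_diff L)
    have "(\<integral>x. (norm (f n x - f N x))\<^sup>2 \<partial>disk_measure) \<le>
        (\<integral>x. 2 * (norm (f n x - h x))\<^sup>2 + 2 * (norm (f N x - h x))\<^sup>2 \<partial>disk_measure)"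
    proof (intro integral_mono L2_integrable_norm_sq L2_diff L)
      show "(norm (f n x - f N x))\<^sup>2 \<le> 2 * (norm (f n x - h x))\<^sup>2 + 2 * (norm (f N x - h x))\<^sup>2" for x
        using norm_add_sq_le[of "f n x - h x" "h x - f N x"] by (simp add: norm_minus_commute)
    qed (use I in auto)
    also have "\<dots> = 2 * (\<integral>x. (norm (f n x - h x))\<^sup>2 \<partial>disk_measure) + 2 * (\<integral>x. (norm (f N x - h x))\<^sup>2 \<partial>disk_measure)"
      using I by simp
    finally show ?thesis using n N by linarith
  qed
  \<comment> \<open>Approximations within \<open>d\<close> of the limit differ by at most \<open>8 d\<close> in squared norm, and
    multiplying by \<open>p\<close> must leave at most \<open>1/32\<close>.\<close>
  define q where "q = 1 / (p\<^sup>2 + 1)"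
  define d where "d = q / 256"
  have "d > 0" by (simp add: d_def q_def add_nonneg_pos)
  have "eventually (\<lambda>n. (\<integral>x. (norm (F n x - u x))\<^sup>2 \<partial>disk_measure) < d \<and>
      (\<integral>x. (norm (G n x - g x))\<^sup>2 \<partial>disk_measure) < d) sequentially"
    by (intro eventually_conj order_tendstoD(2)[OF L2_converges_tendsto[OF Fu] \<open>d > 0\<close>]
      order_tendstoD(2)[OF L2_converges_tendsto[OF Gg] \<open>d > 0\<close>])
  then obtain N where N: "\<And>n. n \<ge> N \<Longrightarrow> (\<integral>x. (norm (F n x - u x))\<^sup>2 \<partial>disk_measure) \<le> d"
      "\<And>n. n \<ge> N \<Longrightarrow> (\<integral>x. (norm (G n x - g x))\<^sup>2 \<partial>disk_measure) \<le> d"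
    unfolding eventually_sequentially by (blast intro: less_imp_le)
  have "bounded ((\<lambda>x. p * F N x) ` unit_disk)"
    by (intro compact_imp_bounded compact_continuous_image continuous_intros cont compact_cball)
  then obtain B where "\<And>x. x \<in> unit_disk \<Longrightarrow> \<bar>p * F N x\<bar> \<le> B"
    unfolding bounded_iff by (metis image_eqI real_norm_def)
  then have B: "p * F N x \<le> B" if "x \<in> unit_disk" for x
    using that by (meson abs_ge_self order_trans)
  define m where "m = exp 1 * measure disk_measure unit_disk"
  have bound: "(\<integral>x. exp (2 * p * F n x) \<partial>disk_measure) \<le> exp (2 * B) * (4 * m)\<^sup>2 \<and>
      (\<integral>x. exp (p * F n x) \<partial>circle_measure) \<le> exp B * (4 * m)" if n: "n \<ge> N" for n
  proof -
    let ?v = "\<lambda>x. p * (F n x - F N x)" and ?V = "\<lambda>x. p *\<^sub>R (G n x - G N x)"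
    have v: "C1_gradient ?v ?V" by (rule C1_gradient_scale_diff[OF C1 C1])
    have "(\<integral>x. (?v x)\<^sup>2 + (norm (?V x))\<^sup>2 \<partial>disk_measure) =
      (\<integral>x. p\<^sup>2 * (norm (F n x - F N x))\<^sup>2 + p\<^sup>2 * (norm (G n x - G N x))\<^sup>2 \<partial>disk_measure)"
      by (simp add: power_mult_distrib)
    also have "\<dots> = (\<integral>x. p\<^sup>2 * (norm (F n x - F N x))\<^sup>2 \<partial>disk_measure) + (\<integral>x. p\<^sup>2 * (norm (G n x - G N x))\<^sup>2 \<partial>disk_measure)"
      by (intro Bochner_Integration.integral_add i continuous_intros cont)
    also have "\<dots> = p\<^sup>2 * ((\<integral>x. (norm (F n x - F N x))\<^sup>2 \<partial>disk_measure) + (\<integral>x. (norm (G n x - G N x))\<^sup>2 \<partial>disk_measure))"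
      by (simp add: distrib_left)
    also have "\<dots> \<le> p\<^sup>2 * (4 * d + 4 * d)"
      by (intro mult_left_mono add_mono near[OF Fu] near[OF Gg] N n) auto
    also have "\<dots> = (p\<^sup>2 * q) / 32"
      by (simp add: d_def)
    also have "\<dots> \<le> 1/32"
      by (simp add: q_def divide_le_eq_1 add_nonneg_pos)
    finally have small: "(\<integral>x. (?v x)\<^sup>2 + (norm (?V x))\<^sup>2 \<partial>disk_measure) \<le> 1/32" .
    note e = exp_integral_bound[OF v small, folded m_def]
    have "(\<integral>x. exp (2 * p * F n x) \<partial>disk_measure) \<le> (\<integral>x. exp (2 * B) * exp (2 * ?v x) \<partial>disk_measure)"
      using B by (intro integral_mono i continuous_intros cont)
        (auto simp flip: exp_add simp: algebra_simps)
    also have "\<dots> \<le> exp (2 * B) * (4 * m)\<^sup>2"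
      using e(1) by simp
    finally have 1: "(\<integral>x. exp (2 * p * F n x) \<partial>disk_measure) \<le> exp (2 * B) * (4 * m)\<^sup>2" .
    have "(\<integral>x. exp (p * F n x) \<partial>circle_measure) \<le> (\<integral>x. exp B * exp (?v x) \<partial>circle_measure)"
      using B by (intro integral_mono i continuous_intros cont)
        (auto simp flip: exp_add simp: algebra_simps)
    also have "\<dots> \<le> exp B * (4 * m)"
      using e(2) by simp
    finally show ?thesis using 1 by blast
  qed
  show "integrable disk_measure (\<lambda>x. exp (2 * p * u x))"
  proof (rule integrable_Fatou)
    show "(\<lambda>x. exp (2 * p * u x)) \<in> borel_measurable disk_measure"
      using L2_measurable[OF H1_trace_imp_L2(1)[OF H]] by measurable
    show "integrable disk_measure (\<lambda>x. exp (2 * p * F n x))" for n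
      by (intro i continuous_intros cont)
    show "AE x in disk_measure. (\<lambda>n. exp (2 * p * F n x)) \<longlonglongrightarrow> exp (2 * p * u x)"
      using ae(1) by eventually_elim (intro tendsto_intros)
    show "eventually (\<lambda>n. (\<integral>x. exp (2 * p * F n x) \<partial>disk_measure) \<le> exp (2 * B) * (4 * m)\<^sup>2) sequentially"
      using bound by (auto simp: eventually_sequentially)
  qed simp
  show "integrable circle_measure (\<lambda>x. exp (p * \<tau> x))"
  proof (rule integrable_Fatou)
    show "(\<lambda>x. exp (p * \<tau> x)) \<in> borel_measurable circle_measure"
      using L2_measurable[OF H1_trace_imp_L2(3)[OF H]] by measurable
    show "integrable circle_measure (\<lambda>x. exp (p * F n x))" for n
      by (intro i continuous_intros cont)
    show "AE x in circle_measure. (\<lambda>n. exp (p * F n x)) \<longlonglongrightarrow> exp (p * \<tau> x)"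
      using ae(2) by eventually_elim (intro tendsto_intros)
    show "eventually (\<lambda>n. (\<integral>x. exp (p * F n x) \<partial>circle_measure) \<le> exp B * (4 * m)) sequentially"
      using bound by (auto simp: eventually_sequentially)
  qed simp
qed

lemma integrable_exp_abs:
  fixes u :: "'a \<Rightarrow> real"
  assumes "integrable M (\<lambda>x. exp (p * u x))" "integrable M (\<lambda>x. exp (- p * u x))" "u \<in> borel_measurable M"
  shows "integrable M (\<lambda>x. exp (p * \<bar>u x\<bar>))"
proof (rule Bochner_Integration.integrable_bound)
  show "integrable M (\<lambda>x. exp (p * u x) + exp (- p * u x))" using assms by auto
  have "exp (p * \<bar>u x\<bar>) \<le> exp (p * u x) + exp (- p * u x)" for x
    by (simp add: abs_if)
  then show "AE x in M. norm (exp (p * \<bar>u x\<bar>)) \<le> norm (exp (p * u x) + exp (- p * u x))"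
    by (intro AE_I2) (simp add: add_nonneg_nonneg)
qed (use assms(3) in measurable)

lemma H1_exp_abs_integrable:
  assumes H: "H1_trace u g \<tau>"
  shows "L2 disk_measure (\<lambda>x. exp \<bar>u x\<bar>)"
    and "integrable circle_measure (\<lambda>x. exp \<bar>\<tau> x\<bar>)"
proof -
  have m: "u \<in> borel_measurable disk_measure" "\<tau> \<in> borel_measurable circle_measure"
    using H1_trace_imp_L2[OF H] by (auto simp: L2_def)
  have "integrable disk_measure (\<lambda>x. exp (2 * \<bar>u x\<bar>))"
    using integrable_exp_abs[of disk_measure 2 u] m H1_exp_integrable(1)[OF H, of 1] H1_exp_integrable(1)[OF H, of "-1"]
    by simp
  then show "L2 disk_measure (\<lambda>x. exp \<bar>u x\<bar>)"
    using m by (simp add: L2_def exp_double)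
  show "integrable circle_measure (\<lambda>x. exp \<bar>\<tau> x\<bar>)"
    using integrable_exp_abs[of circle_measure 1 \<tau>] m H1_exp_integrable(2)[OF H, of 1] H1_exp_integrable(2)[OF H, of "-1"]
    by simp
qed

section \<open>Calculus for Sobolev functions\<close>

text \<open>Integration by parts holds for the approximations, with no boundary term because the test function
  vanishes on the circle, and both sides are continuous for \<open>L\<^sup>2\<close> convergence.\<close>

lemma weak_gradient_of_limit:
  assumes C1: "\<And>n. C1_gradient (F n) (G n)"
    and Fu: "L2_converges disk_measure F u" and Gg: "L2_converges disk_measure G g"
  shows "weak_gradient u g"
  unfolding weak_gradient_def
proof (intro allI impI, elim conjE)
  fix \<psi> D S assume \<psi>: "C1_gradient \<psi> D" and S: "S \<subseteq> ball (0::real \<times> real) 1" "\<forall>x. x \<notin> S \<longrightarrow> \<psi> x = 0"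
  note cont = C1_gradient_continuous[OF \<psi>] C1_gradient_continuous[OF C1]
  have "bounded (D ` unit_disk)" "bounded (\<psi> ` unit_disk)"
    by (intro compact_imp_bounded compact_continuous_image cont compact_cball)+
  then obtain B1 B2 where B: "\<And>x. x \<in> unit_disk \<Longrightarrow> norm (D x) \<le> B1" "\<And>x. x \<in> unit_disk \<Longrightarrow> norm (\<psi> x) \<le> B2"
    unfolding bounded_iff by (metis image_eqI)
  have parts: "(\<integral>x. F n x *\<^sub>R D x \<partial>disk_measure) = - (\<integral>x. \<psi> x *\<^sub>R G n x \<partial>disk_measure)" for n
  proof -
    have "(\<integral>x. F n x *\<^sub>R D x + \<psi> x *\<^sub>R G n x \<partial>disk_measure) = (\<integral>x. (F n x * \<psi> x) *\<^sub>R x \<partial>circle_measure)"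
      by (rule Gauss_Green_disk[OF C1_gradient_mult[OF C1 \<psi>]])
    also have "\<dots> = (\<integral>x. 0 \<partial>circle_measure)"
    proof (rule Bochner_Integration.integral_cong)
      fix x :: "real \<times> real" assume "x \<in> space circle_measure"
      then have "x \<notin> S" using S(1) by force
      then have "\<psi> x = 0" using S(2) by blast
      then show "(F n x * \<psi> x) *\<^sub>R x = 0" by simp
    qed simp
    finally have "(\<integral>x. F n x *\<^sub>R D x + \<psi> x *\<^sub>R G n x \<partial>disk_measure) = 0" by simp
    moreover have "(\<integral>x. F n x *\<^sub>R D x + \<psi> x *\<^sub>R G n x \<partial>disk_measure) =
        (\<integral>x. F n x *\<^sub>R D x \<partial>disk_measure) + (\<integral>x. \<psi> x *\<^sub>R G n x \<partial>disk_measure)"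
      by (intro Bochner_Integration.integral_add integrable_disk_continuous continuous_intros cont)
    ultimately show ?thesis by (simp add: eq_neg_iff_add_eq_0)
  qed
  have 1: "(\<lambda>n. \<integral>x. F n x *\<^sub>R D x \<partial>disk_measure) \<longlonglongrightarrow> (\<integral>x. u x *\<^sub>R D x \<partial>disk_measure)"
    by (rule L2_converges_integral_product[OF bounded_bilinear.flip[OF bounded_bilinear_scaleR] finite_disk_measure Fu])
      (use B in \<open>auto intro!: measurable_disk_continuous cont\<close>)
  have "(\<lambda>n. \<integral>x. \<psi> x *\<^sub>R G n x \<partial>disk_measure) \<longlonglongrightarrow> (\<integral>x. \<psi> x *\<^sub>R g x \<partial>disk_measure)"
    by (rule L2_converges_integral_product[OF bounded_bilinear_scaleR finite_disk_measure Gg])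
      (use B in \<open>auto intro!: measurable_disk_continuous cont\<close>)
  then have "(\<lambda>n. \<integral>x. F n x *\<^sub>R D x \<partial>disk_measure) \<longlonglongrightarrow> - (\<integral>x. \<psi> x *\<^sub>R g x \<partial>disk_measure)"
    unfolding parts by (rule tendsto_minus)
  with 1 show "(\<integral>x. u x *\<^sub>R D x \<partial>disk_measure) = - (\<integral>x. \<psi> x *\<^sub>R g x \<partial>disk_measure)"
    by (rule LIMSEQ_unique)
qed

lemma radial_divergence_H1:
  assumes "H1_trace u g \<tau>"
  shows "integrable disk_measure (\<lambda>x. x \<bullet> g x)"
    and "(\<integral>x. \<tau> x \<partial>circle_measure) = (\<integral>x. 2 * u x + x \<bullet> g x \<partial>disk_measure)"
proof -
  obtain F G where C1: "\<And>n. C1_gradient (F n) (G n)" and Fu: "L2_converges disk_measure F u"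
    and Gg: "L2_converges disk_measure G g" and Ft: "L2_converges circle_measure F \<tau>"
    using assms by (auto simp: H1_trace_def)
  note cont = C1_gradient_continuous[OF C1]
  have id: "(\<lambda>x. x) \<in> borel_measurable disk_measure"
    by (intro measurable_disk_continuous continuous_intros)
  have gm: "g \<in> borel_measurable disk_measure"
    by (rule L2_measurable[OF H1_trace_imp_L2(2)[OF assms]])
  have "L2 disk_measure (\<lambda>x. x \<bullet> g x)"
  proof (rule L2_bound[OF H1_trace_imp_L2(2)[OF assms], of _ 1])
    show "(\<lambda>x. x \<bullet> g x) \<in> borel_measurable disk_measure" using id gm by measurable
    show "norm (x \<bullet> g x) \<le> 1 * norm (g x)" if "x \<in> space disk_measure" for x
      using that unfolding real_norm_def
      by (intro order_trans[OF Cauchy_Schwarz_ineq2] mult_right_mono) auto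
  qed
  then show ig: "integrable disk_measure (\<lambda>x. x \<bullet> g x)" by (rule disk.L2_integrable)
  have iu: "integrable disk_measure u" by (rule disk.L2_integrable[OF H1_trace_imp_L2(1)[OF assms]])
  have lim1: "(\<lambda>n. \<integral>x. 1 *\<^sub>R F n x \<partial>circle_measure) \<longlonglongrightarrow> (\<integral>x. 1 *\<^sub>R \<tau> x \<partial>circle_measure)"
    by (rule L2_converges_integral_product[OF bounded_bilinear_scaleR finite_circle_measure Ft, of _ 1]) auto
  have lim2: "(\<lambda>n. \<integral>x. 2 *\<^sub>R F n x \<partial>disk_measure) \<longlonglongrightarrow> (\<integral>x. 2 *\<^sub>R u x \<partial>disk_measure)"
    by (rule L2_converges_integral_product[OF bounded_bilinear_scaleR finite_disk_measure Fu, of _ 2]) auto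
  have lim3: "(\<lambda>n. \<integral>x. x \<bullet> G n x \<partial>disk_measure) \<longlonglongrightarrow> (\<integral>x. x \<bullet> g x \<partial>disk_measure)"
    by (rule L2_converges_integral_product[OF bounded_bilinear_inner finite_disk_measure Gg id, of 1]) auto
  have "(\<integral>x. 1 *\<^sub>R F n x \<partial>circle_measure) =
      (\<integral>x. 2 *\<^sub>R F n x \<partial>disk_measure) + (\<integral>x. x \<bullet> G n x \<partial>disk_measure)" for n
    unfolding real_scaleR_def mult_1 radial_divergence_C1[OF C1]
    by (intro Bochner_Integration.integral_add integrable_disk_continuous continuous_intros cont)
  then have "(\<integral>x. 1 *\<^sub>R \<tau> x \<partial>circle_measure) = (\<integral>x. 2 *\<^sub>R u x \<partial>disk_measure) + (\<integral>x. x \<bullet> g x \<partial>disk_measure)"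
    using LIMSEQ_unique[OF lim1] tendsto_add[OF lim2 lim3] by simp
  then show "(\<integral>x. \<tau> x \<partial>circle_measure) = (\<integral>x. 2 * u x + x \<bullet> g x \<partial>disk_measure)"
    using iu ig by simp
qed

lemma measurable_compose_continuous:
  fixes u :: "'a::euclidean_space \<Rightarrow> real" and \<Theta> :: "real \<Rightarrow> 'a \<Rightarrow> 'b::euclidean_space"
  assumes "continuous_on UNIV (\<lambda>(y, x). \<Theta> y x)" "u \<in> borel_measurable M" "(\<lambda>x. x) \<in> borel_measurable M"
  shows "(\<lambda>x. \<Theta> (u x) x) \<in> borel_measurable M"
  using borel_measurable_continuous_Pair[OF assms(2,3), of \<Theta>] assms(1)
  by (simp add: case_prod_unfold)

lemma tendsto_compose_continuous:
  fixes y :: real and x :: "'a::euclidean_space" and \<Theta> :: "real \<Rightarrow> 'a \<Rightarrow> 'b::euclidean_space"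
  assumes "continuous_on UNIV (\<lambda>(y, x). \<Theta> y x)" "Y \<longlonglongrightarrow> y"
  shows "(\<lambda>n. \<Theta> (Y n) x) \<longlonglongrightarrow> \<Theta> y x"
proof -
  have "isCont (\<lambda>(y, x). \<Theta> y x) (y, x)"
    using assms(1) by (simp add: continuous_on_eq_continuous_at)
  from isCont_tendsto_compose[OF this tendsto_Pair[OF assms(2) tendsto_const]] show ?thesis by simp
qed

lemma (in finite_measure) bounded_AE_imp_L2_converges:
  fixes f :: "'a \<Rightarrow> real"
  assumes m: "\<And>n. F n \<in> borel_measurable M" "f \<in> borel_measurable M"
    and b: "\<And>n x. x \<in> space M \<Longrightarrow> \<bar>F n x\<bar> \<le> C" "\<And>x. x \<in> space M \<Longrightarrow> \<bar>f x\<bar> \<le> C"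
    and ae: "AE x in M. (\<lambda>n. F n x) \<longlonglongrightarrow> f x"
  shows "L2_converges M F f"
  unfolding L2_converges_def
proof (intro conjI allI)
  show "L2 M (F n)" for n by (rule L2_bounded[of _ C]) (use m b in auto)
  show "L2 M f" by (rule L2_bounded[of _ C]) (use m b in auto)
  have "(\<lambda>n. \<integral>x. (norm (F n x - f x))\<^sup>2 \<partial>M) \<longlonglongrightarrow> (\<integral>x. 0 \<partial>M)"
  proof (rule integral_dominated_convergence)
    show "integrable M (\<lambda>x. (2 * C)\<^sup>2)" by simp
    show "AE x in M. (\<lambda>n. (norm (F n x - f x))\<^sup>2) \<longlonglongrightarrow> 0"
      using ae
    proof eventually_elim
      case (elim x)
      have "(\<lambda>n. (norm (F n x - f x))\<^sup>2) \<longlonglongrightarrow> (norm (f x - f x))\<^sup>2"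
        by (intro tendsto_intros elim)
      then show ?case by simp
    qed
    show "AE x in M. norm ((norm (F n x - f x))\<^sup>2) \<le> (2 * C)\<^sup>2" for n
    proof (rule AE_I2)
      fix x assume x: "x \<in> space M"
      have "(norm (F n x - f x))\<^sup>2 \<le> (2 * C)\<^sup>2"
        using b(1)[OF x, of n] b(2)[OF x] by (intro power_mono) auto
      then show "norm ((norm (F n x - f x))\<^sup>2) \<le> (2 * C)\<^sup>2" by simp
    qed
  qed (use m in measurable)
  then show "(\<lambda>n. \<integral>x. (norm (F n x - f x))\<^sup>2 \<partial>M) \<longlonglongrightarrow> 0" by simp
qed

text \<open>The chain rule. Along approximations \<open>F, G\<close> of \<open>u, g\<close> that converge almost everywhere, the
  error of the gradients is \<open>P(F) (G - g)\<close>, small because \<open>P\<close> is bounded, plus a remainder that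
  tends to \<open>0\<close> almost everywhere and is dominated by a multiple of \<open>|g| + 1\<close>.\<close>

lemma H1_trace_compose:
  fixes \<Theta> P :: "real \<Rightarrow> real \<times> real \<Rightarrow> real" and Q :: "real \<Rightarrow> real \<times> real \<Rightarrow> real \<times> real"
  assumes H: "H1_trace u g \<tau>"
    and der: "\<And>y x. ((\<lambda>(y, x). \<Theta> y x) has_derivative (\<lambda>(s, k). s * P y x + k \<bullet> Q y x)) (at (y, x))"
    and cP: "continuous_on UNIV (\<lambda>(y, x). P y x)" and cQ: "continuous_on UNIV (\<lambda>(y, x). Q y x)"
    and bound: "\<And>y x. x \<in> unit_disk \<Longrightarrow> \<bar>\<Theta> y x\<bar> \<le> C" "\<And>y x. x \<in> unit_disk \<Longrightarrow> \<bar>P y x\<bar> \<le> C"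
      "\<And>y x. x \<in> unit_disk \<Longrightarrow> norm (Q y x) \<le> C"
  shows "H1_trace (\<lambda>x. \<Theta> (u x) x) (\<lambda>x. P (u x) x *\<^sub>R g x + Q (u x) x) (\<lambda>x. \<Theta> (\<tau> x) x)"
proof -
  obtain F G where C1: "\<And>n. C1_gradient (F n) (G n)" and Fu: "L2_converges disk_measure F u"
    and Gg: "L2_converges disk_measure G g" and Ft: "L2_converges circle_measure F \<tau>"
    and ae: "AE x in disk_measure. (\<lambda>n. F n x) \<longlonglongrightarrow> u x" "AE x in circle_measure. (\<lambda>n. F n x) \<longlonglongrightarrow> \<tau> x"
    by (rule H1_trace_AE_approximation[OF H]) (blast intro: that)
  note cont = C1_gradient_continuous[OF C1]
  note L = H1_trace_imp_L2[OF H]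
  have c\<Theta>: "continuous_on UNIV (\<lambda>(y, x). \<Theta> y x)"
    using der by (intro differentiable_imp_continuous_on)
      (auto simp: differentiable_on_def differentiable_def intro: has_derivative_at_withinI)
  have id: "(\<lambda>x. x) \<in> borel_measurable disk_measure" "(\<lambda>x. x) \<in> borel_measurable circle_measure"
    by (intro measurable_disk_continuous measurable_circle_continuous continuous_intros)+
  have Fm: "F n \<in> borel_measurable disk_measure" "F n \<in> borel_measurable circle_measure" for n
    by (intro measurable_disk_continuous measurable_circle_continuous cont)+
  have Gm: "G n \<in> borel_measurable disk_measure" for n
    by (intro measurable_disk_continuous cont)
  have um: "u \<in> borel_measurable disk_measure" "g \<in> borel_measurable disk_measure" "\<tau> \<in> borel_measurable circle_measure"
    using L by (auto simp: L2_def)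
  note m = measurable_compose_continuous
  let ?F = "\<lambda>n x. \<Theta> (F n x) x" and ?G = "\<lambda>n x. P (F n x) x *\<^sub>R G n x + Q (F n x) x"
  let ?u = "\<lambda>x. \<Theta> (u x) x" and ?g = "\<lambda>x. P (u x) x *\<^sub>R g x + Q (u x) x"
  have Capp: "C1_gradient (?F n) (?G n)" for n
    unfolding C1_gradient_def gderiv_def
  proof (intro conjI allI)
    fix x
    have "(F n has_derivative (\<lambda>h. h \<bullet> G n x)) (at x)"
      using C1[of n] unfolding C1_gradient_def gderiv_def by blast
    then have "((\<lambda>x. (F n x, x)) has_derivative (\<lambda>h. (h \<bullet> G n x, h))) (at x)"
      by (intro has_derivative_Pair has_derivative_ident)
    from has_derivative_compose[OF this der]
    show "(?F n has_derivative (\<lambda>h. h \<bullet> ?G n x)) (at x)"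
      by (simp add: inner_add_right mult.commute)
    have "continuous_on UNIV (\<lambda>x. (F n x, x))" by (intro continuous_intros cont)
    from continuous_on_compose2[OF cP this] continuous_on_compose2[OF cQ this]
    show "continuous_on UNIV (?G n)" by (intro continuous_intros cont) auto
  qed
  have conv1: "L2_converges disk_measure ?F ?u"
  proof (rule disk.bounded_AE_imp_L2_converges[of _ _ C])
    show "AE x in disk_measure. (\<lambda>n. ?F n x) \<longlonglongrightarrow> ?u x"
      using ae(1) by eventually_elim (rule tendsto_compose_continuous[OF c\<Theta>])
  qed (use bound in \<open>auto intro: m[OF c\<Theta>] Fm um id\<close>)
  have conv3: "L2_converges circle_measure ?F (\<lambda>x. \<Theta> (\<tau> x) x)"
  proof (rule circle.bounded_AE_imp_L2_converges[of _ _ C])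
    show "AE x in circle_measure. (\<lambda>n. ?F n x) \<longlonglongrightarrow> \<Theta> (\<tau> x) x"
      using ae(2) by eventually_elim (rule tendsto_compose_continuous[OF c\<Theta>])
  qed (use bound in \<open>auto intro: m[OF c\<Theta>] Fm um id\<close>)
  have PG: "L2 disk_measure (\<lambda>x. P (v x) x *\<^sub>R w x)"
    if "L2 disk_measure w" "v \<in> borel_measurable disk_measure" for v w
  proof (rule L2_bound[OF that(1), of _ C])
    show "(\<lambda>x. P (v x) x *\<^sub>R w x) \<in> borel_measurable disk_measure"
      using m[OF cP that(2) id(1)] L2_measurable[OF that(1)] by measurable
    show "norm (P (v x) x *\<^sub>R w x) \<le> C * norm (w x)" if "x \<in> space disk_measure" for x
      using bound(2)[of x "v x"] that by (auto intro!: mult_right_mono)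
  qed
  have QL: "L2 disk_measure (\<lambda>x. Q (v x) x)" if "v \<in> borel_measurable disk_measure" for v
    by (rule disk.L2_bounded[of _ C]) (use m[OF cQ that id(1)] bound(3) in auto)
  have conv2: "L2_converges disk_measure ?G ?g"
    unfolding L2_converges_def
  proof (intro conjI allI)
    show LG: "L2 disk_measure (?G n)" for n
      by (intro L2_add PG QL L2_converges_imp_L2(1)[OF Gg] Fm)
    show Lg: "L2 disk_measure ?g"
      by (intro L2_add PG QL L um)
    let ?A = "\<lambda>n x. P (F n x) x *\<^sub>R (G n x - g x)"
    let ?R = "\<lambda>n x. (P (F n x) x - P (u x) x) *\<^sub>R g x + (Q (F n x) x - Q (u x) x)"
    have LA: "L2 disk_measure (?A n)" for n
      by (intro PG L2_diff L2_converges_imp_L2(1)[OF Gg] L Fm)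
    have LR: "L2 disk_measure (?R n)" for n
      unfolding scaleR_diff_left
      by (intro L2_add L2_diff PG QL L um Fm)
    have "(\<lambda>n. \<integral>x. (norm (?R n x))\<^sup>2 \<partial>disk_measure) \<longlonglongrightarrow> (\<integral>x. 0 \<partial>disk_measure)"
    proof (rule integral_dominated_convergence)
      have "L2 disk_measure (\<lambda>x. 2 * C)" by (rule disk.L2_bounded) auto
      from L2_add[OF L2_scaleR[OF L2_norm[OF L(2)], of "2 * C"] this]
      show "integrable disk_measure (\<lambda>x. (2 * C * norm (g x) + 2 * C)\<^sup>2)"
        by (auto dest: L2_integrable_norm_sq)
      show "AE x in disk_measure. (\<lambda>n. (norm (?R n x))\<^sup>2) \<longlonglongrightarrow> 0"
        using ae(1)
      proof eventually_elim
        case (elim x)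
        have "(\<lambda>n. (norm (?R n x))\<^sup>2) \<longlonglongrightarrow>
            (norm ((P (u x) x - P (u x) x) *\<^sub>R g x + (Q (u x) x - Q (u x) x)))\<^sup>2"
          by (intro tendsto_intros tendsto_compose_continuous[OF cP] tendsto_compose_continuous[OF cQ] elim)
        then show ?case by simp
      qed
      show "AE x in disk_measure. norm ((norm (?R n x))\<^sup>2) \<le> (2 * C * norm (g x) + 2 * C)\<^sup>2" for n
      proof (rule AE_I2)
        fix x assume "x \<in> space disk_measure"
        then have x: "x \<in> unit_disk" by simp
        have "\<bar>P (F n x) x - P (u x) x\<bar> \<le> 2 * C"
          using bound(2)[OF x, of "F n x"] bound(2)[OF x, of "u x"] by linarith
        moreover have "norm (Q (F n x) x - Q (u x) x) \<le> 2 * C"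
          using norm_triangle_ineq4[of "Q (F n x) x" "Q (u x) x"] bound(3)[OF x, of "F n x"] bound(3)[OF x, of "u x"]
          by linarith
        ultimately have "norm (?R n x) \<le> 2 * C * norm (g x) + 2 * C"
          by (intro norm_triangle_le add_mono) (auto intro!: mult_right_mono)
        then have "(norm (?R n x))\<^sup>2 \<le> (2 * C * norm (g x) + 2 * C)\<^sup>2"
          by (rule power_mono) simp
        then show "norm ((norm (?R n x))\<^sup>2) \<le> (2 * C * norm (g x) + 2 * C)\<^sup>2" by simp
      qed
    qed (use LR in \<open>auto simp: L2_def\<close>)
    then have R0: "(\<lambda>n. \<integral>x. (norm (?R n x))\<^sup>2 \<partial>disk_measure) \<longlonglongrightarrow> 0" by simp
    have A_le: "(\<integral>x. (norm (?A n x))\<^sup>2 \<partial>disk_measure) \<le> C\<^sup>2 * (\<integral>x. (norm (G n x - g x))\<^sup>2 \<partial>disk_measure)" for n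
    proof -
      have "(\<integral>x. (norm (?A n x))\<^sup>2 \<partial>disk_measure) \<le> (\<integral>x. C\<^sup>2 * (norm (G n x - g x))\<^sup>2 \<partial>disk_measure)"
      proof (intro integral_mono L2_integrable_norm_sq[OF LA])
        show "integrable disk_measure (\<lambda>x. C\<^sup>2 * (norm (G n x - g x))\<^sup>2)"
          using L2_integrable_norm_sq[OF L2_diff[OF L2_converges_imp_L2(1)[OF Gg] L(2)]] by simp
        fix x assume "x \<in> space disk_measure"
        then have "\<bar>P (F n x) x\<bar>\<^sup>2 \<le> C\<^sup>2" by (intro power_mono bound(2)) auto
        then show "(norm (?A n x))\<^sup>2 \<le> C\<^sup>2 * (norm (G n x - g x))\<^sup>2"
          by (simp add: power_mult_distrib mult_right_mono)
      qed
      then show ?thesis by simp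
    qed
    have le: "(\<integral>x. (norm (?G n x - ?g x))\<^sup>2 \<partial>disk_measure) \<le>
        2 * (C\<^sup>2 * (\<integral>x. (norm (G n x - g x))\<^sup>2 \<partial>disk_measure)) + 2 * (\<integral>x. (norm (?R n x))\<^sup>2 \<partial>disk_measure)" for n
    proof -
      have "(\<integral>x. (norm (?G n x - ?g x))\<^sup>2 \<partial>disk_measure) \<le>
          (\<integral>x. 2 * (norm (?A n x))\<^sup>2 + 2 * (norm (?R n x))\<^sup>2 \<partial>disk_measure)"
      proof (intro integral_mono L2_integrable_norm_sq[OF L2_diff[OF LG Lg]])
        show "integrable disk_measure (\<lambda>x. 2 * (norm (?A n x))\<^sup>2 + 2 * (norm (?R n x))\<^sup>2)"
          using L2_integrable_norm_sq[OF LA] L2_integrable_norm_sq[OF LR] by simp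
        have "?G n x - ?g x = ?A n x + ?R n x" for x by (simp add: algebra_simps)
        then show "(norm (?G n x - ?g x))\<^sup>2 \<le> 2 * (norm (?A n x))\<^sup>2 + 2 * (norm (?R n x))\<^sup>2" for x
          using norm_add_sq_le[of "?A n x" "?R n x"] by (simp only:)
      qed
      also have "\<dots> = 2 * (\<integral>x. (norm (?A n x))\<^sup>2 \<partial>disk_measure) + 2 * (\<integral>x. (norm (?R n x))\<^sup>2 \<partial>disk_measure)"
        using L2_integrable_norm_sq[OF LA] L2_integrable_norm_sq[OF LR] by simp
      finally show ?thesis using A_le[of n] by linarith
    qed
    have "(\<lambda>n. 2 * (C\<^sup>2 * (\<integral>x. (norm (G n x - g x))\<^sup>2 \<partial>disk_measure)) +
        2 * (\<integral>x. (norm (?R n x))\<^sup>2 \<partial>disk_measure)) \<longlonglongrightarrow> 2 * (C\<^sup>2 * 0) + 2 * 0"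
      by (intro tendsto_intros L2_converges_tendsto[OF Gg] R0)
    then have lim0: "(\<lambda>n. 2 * (C\<^sup>2 * (\<integral>x. (norm (G n x - g x))\<^sup>2 \<partial>disk_measure)) +
        2 * (\<integral>x. (norm (?R n x))\<^sup>2 \<partial>disk_measure)) \<longlonglongrightarrow> 0" by simp
    show "(\<lambda>n. \<integral>x. (norm (?G n x - ?g x))\<^sup>2 \<partial>disk_measure) \<longlonglongrightarrow> 0"
      by (rule tendsto_sandwich[OF always_eventually always_eventually tendsto_const lim0]) (use le in auto)
  qed
  have "H1_disk ?u ?g"
    unfolding H1_disk_def
    using weak_gradient_of_limit[OF Capp conv1 conv2] L2_converges_imp_L2(2)[OF conv1] L2_converges_imp_L2(2)[OF conv2]
    by blast
  then show ?thesis
    unfolding H1_trace_def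
    by (intro conjI exI[of _ ?F] exI[of _ ?G] allI Capp conv1 conv2 conv3)
qed

section \<open>The weak form of the equation\<close>

text \<open>The functional is differentiated under the integral by bounding its second-order remainder, which
  for a bounded direction is controlled by the exponentials of \<open>u\<close> and \<open>\<tau>/2\<close> themselves.\<close>

lemma exp_Taylor_quadratic: "\<bar>exp a - 1 - a\<bar> \<le> a\<^sup>2 * exp \<bar>a\<bar>" for a :: real
proof -
  have ge: "0 \<le> exp a - 1 - a" using exp_ge_add_one_self[of a] by linarith
  have "exp a * (1 - a) \<le> exp a * exp (- a)"
    using exp_ge_add_one_self[of "- a"] by (intro mult_left_mono) auto
  then have "exp a * (1 - a) \<le> 1" by (simp add: exp_minus)
  then have le: "exp a - 1 \<le> a * exp a" by (simp add: algebra_simps)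
  have "a * (exp a - 1) \<le> a\<^sup>2 * exp \<bar>a\<bar>"
  proof (cases "a \<ge> 0")
    case True
    with mult_left_mono[OF le True] show ?thesis by (simp add: power2_eq_square mult.assoc)
  next
    case False
    have "(- a) * (1 - exp a) \<le> (- a) * (- a)"
      using False exp_ge_add_one_self[of a] by (intro mult_left_mono) linarith+
    also have "\<dots> \<le> a\<^sup>2 * exp \<bar>a\<bar>"
      by (simp add: power2_eq_square mult_le_cancel_left1)
    finally show ?thesis by (simp add: algebra_simps)
  qed
  with ge le show ?thesis by (simp add: algebra_simps)
qed

lemma has_real_derivative_integral:
  fixes f :: "real \<Rightarrow> 'a \<Rightarrow> real"
  assumes f0: "integrable M (f 0)" and fm: "\<And>t. f t \<in> borel_measurable M"
    and l: "integrable M l" and q: "integrable M q"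
    and bound: "\<And>t x. x \<in> space M \<Longrightarrow> \<bar>t\<bar> \<le> 1 \<Longrightarrow> \<bar>f t x - f 0 x - t * l x\<bar> \<le> t\<^sup>2 * q x"
  shows "((\<lambda>t. \<integral>x. f t x \<partial>M) has_real_derivative (\<integral>x. l x \<partial>M)) (at 0)"
proof -
  define E L Q where "E t = (\<integral>x. f t x \<partial>M)" and "L = (\<integral>x. l x \<partial>M)" and "Q = (\<integral>x. q x \<partial>M)" for t
  have rem: "\<bar>E t - E 0 - t * L\<bar> \<le> t\<^sup>2 * Q" if t: "\<bar>t\<bar> \<le> 1" for t
  proof -
    have qt: "integrable M (\<lambda>x. t\<^sup>2 * q x)" using q by simp
    have r: "integrable M (\<lambda>x. f t x - f 0 x - t * l x)"
    proof (rule Bochner_Integration.integrable_bound[OF qt])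
      show "(\<lambda>x. f t x - f 0 x - t * l x) \<in> borel_measurable M"
        using fm l by measurable
      show "AE x in M. norm (f t x - f 0 x - t * l x) \<le> norm (t\<^sup>2 * q x)"
        by (rule AE_I2) (use bound[OF _ t] in \<open>force intro: order_trans[OF _ abs_ge_self]\<close>)
    qed
    have "integrable M (\<lambda>x. (f t x - f 0 x - t * l x) + f 0 x + t * l x)"
      by (intro Bochner_Integration.integrable_add r f0 integrable_mult_right l)
    then have ft: "integrable M (f t)" by simp
    have "E t - E 0 - t * L = (\<integral>x. f t x - f 0 x - t * l x \<partial>M)"
      using ft f0 l by (simp add: E_def L_def)
    also have "\<bar>\<dots>\<bar> \<le> (\<integral>x. \<bar>f t x - f 0 x - t * l x\<bar> \<partial>M)"
      by (rule integral_abs_bound)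
    also have "\<dots> \<le> (\<integral>x. t\<^sup>2 * q x \<partial>M)"
      by (intro integral_mono integrable_abs r qt bound t)
    finally show ?thesis by (simp add: Q_def)
  qed
  have "((\<lambda>t. (E (0 + t) - E 0) / t - L) \<longlongrightarrow> 0) (at 0)"
  proof (rule Lim_null_comparison)
    have "((\<lambda>t. \<bar>t\<bar> * Q) \<longlongrightarrow> \<bar>0\<bar> * Q) (at 0)" by (intro tendsto_intros)
    then show "((\<lambda>t. \<bar>t\<bar> * Q) \<longlongrightarrow> 0) (at 0)" by simp
    have "norm ((E (0 + t) - E 0) / t - L) \<le> \<bar>t\<bar> * Q" if "t \<noteq> 0" "\<bar>t\<bar> < 1" for t
    proof -
      have "(E (0 + t) - E 0) / t - L = (E t - E 0 - t * L) / t"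
        using that by (simp add: diff_divide_distrib)
      also have "norm \<dots> \<le> t\<^sup>2 * Q / \<bar>t\<bar>"
        using rem[of t] that by (simp add: divide_right_mono)
      also have "t\<^sup>2 * Q / \<bar>t\<bar> = \<bar>t\<bar> * Q"
      proof -
        have "t\<^sup>2 = \<bar>t\<bar> * \<bar>t\<bar>" by (simp add: power2_eq_square)
        then show ?thesis using that by (simp only: mult.assoc) (simp del: abs_mult_self_eq)
      qed
      finally show ?thesis .
    qed
    then show "\<forall>\<^sub>F t in at 0. norm ((E (0 + t) - E 0) / t - L) \<le> \<bar>t\<bar> * Q"
      unfolding eventually_at by (intro exI[of _ 1]) auto
  qed
  then have "((\<lambda>t. (E (0 + t) - E 0) / t) \<longlongrightarrow> L) (at 0)" by (rule LIM_zero_cancel)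
  then show ?thesis unfolding DERIV_def E_def L_def .
qed

lemma exp_perturbation_bound:
  fixes k a b w B C :: real
  assumes "\<bar>k\<bar> \<le> C" "\<bar>w\<bar> \<le> B" "\<bar>t\<bar> \<le> 1"
  shows "\<bar>k * exp (a + t * w) - k * exp a - t * (k * exp a * w)\<bar> \<le> t\<^sup>2 * (C * B\<^sup>2 * exp B * exp a)"
proof -
  have tw: "\<bar>t * w\<bar> \<le> B"
    using mult_mono[OF assms(3,2)] by (simp add: abs_mult)
  have "\<bar>exp (t * w) - 1 - t * w\<bar> \<le> (t * w)\<^sup>2 * exp \<bar>t * w\<bar>"
    by (rule exp_Taylor_quadratic)
  also have "\<dots> \<le> (t\<^sup>2 * B\<^sup>2) * exp B"
    unfolding power_mult_distrib
    using assms(2) tw by (intro mult_mono mult_left_mono) (auto simp: abs_le_square_iff[symmetric])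
  finally have r: "\<bar>exp (t * w) - 1 - t * w\<bar> \<le> (t\<^sup>2 * B\<^sup>2) * exp B" .
  have "k * exp (a + t * w) - k * exp a - t * (k * exp a * w) = k * exp a * (exp (t * w) - 1 - t * w)"
    by (simp add: exp_add algebra_simps)
  also have "\<bar>\<dots>\<bar> = (\<bar>k\<bar> * exp a) * \<bar>exp (t * w) - 1 - t * w\<bar>"
    by (simp add: abs_mult)
  also have "\<dots> \<le> (C * exp a) * ((t\<^sup>2 * B\<^sup>2) * exp B)"
    using assms(1) r by (intro mult_mono) auto
  finally show ?thesis by (simp add: ac_simps)
qed

lemma continuous_on_compact_bounded:
  fixes f :: "real \<times> real \<Rightarrow> real"
  assumes "continuous_on S f" "compact S"
  obtains C where "\<And>x. x \<in> S \<Longrightarrow> \<bar>f x\<bar> \<le> C"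
proof -
  have "bounded (f ` S)"
    by (intro compact_imp_bounded compact_continuous_image assms)
  then show ?thesis
    using that unfolding bounded_iff by (metis image_eqI real_norm_def)
qed

text \<open>The Euler--Lagrange equation. Bounded directions suffice below, and for them exponential
  integrability of \<open>u\<close> and \<open>\<tau>\<close> gives the derivative of the functional.\<close>

lemma weak_equation:
  assumes K: "continuous_on unit_disk K" and h: "continuous_on (sphere 0 1) h"
    and H: "H1_trace u g \<tau>" and T: "H1_trace \<phi> d \<sigma>"
    and b: "\<And>x. x \<in> unit_disk \<Longrightarrow> \<bar>\<phi> x\<bar> \<le> B" "\<And>x. x \<in> sphere 0 1 \<Longrightarrow> \<bar>\<sigma> x\<bar> \<le> B"
    and crit: "((\<lambda>t. energy K h (\<lambda>x. u x + t * \<phi> x) (\<lambda>x. g x + t *\<^sub>R d x) (\<lambda>x. \<tau> x + t * \<sigma> x))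
              has_real_derivative 0) (at 0)"
  shows "integrable disk_measure (\<lambda>x. g x \<bullet> d x - 2 * K x * exp (u x) * \<phi> x)"
    and "integrable circle_measure (\<lambda>x. 2 * \<sigma> x - 2 * h x * exp (\<tau> x / 2) * \<sigma> x)"
    and "(\<integral>x. g x \<bullet> d x - 2 * K x * exp (u x) * \<phi> x \<partial>disk_measure) +
      (\<integral>x. 2 * \<sigma> x - 2 * h x * exp (\<tau> x / 2) * \<sigma> x \<partial>circle_measure) = 0"
proof -
  note L = H1_trace_imp_L2[OF H] and LT = H1_trace_imp_L2[OF T]
  note [measurable] = L[THEN L2_measurable] LT[THEN L2_measurable]
    measurable_disk_continuous[OF K] measurable_circle_continuous[OF h]
  obtain C1 where C1: "\<And>x. x \<in> unit_disk \<Longrightarrow> \<bar>K x\<bar> \<le> C1"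
    using continuous_on_compact_bounded[OF K compact_cball] by blast
  obtain C2 where C2: "\<And>x. x \<in> sphere 0 1 \<Longrightarrow> \<bar>h x\<bar> \<le> C2"
    using continuous_on_compact_bounded[OF h compact_sphere] by blast
  have eu: "integrable disk_measure (\<lambda>x. exp (u x))"
    using H1_exp_integrable(1)[OF H, of "1/2"] by simp
  have et: "integrable circle_measure (\<lambda>x. exp (\<tau> x / 2))"
    using H1_exp_integrable(2)[OF H, of "1/2"] by simp
  have bdd: "integrable disk_measure (\<lambda>x. w x * exp (u x))"
    if "w \<in> borel_measurable disk_measure" "\<And>x. x \<in> unit_disk \<Longrightarrow> \<bar>w x\<bar> \<le> C" for w C
    by (rule Bochner_Integration.integrable_bound[OF integrable_mult_right[OF eu, of C]])
      (use that in \<open>auto simp: abs_mult intro!: AE_I2 mult_right_mono intro: order_trans[OF _ abs_ge_self]\<close>)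
  have bdc: "integrable circle_measure (\<lambda>x. w x * exp (\<tau> x / 2))"
    if "w \<in> borel_measurable circle_measure" "\<And>x. x \<in> sphere 0 1 \<Longrightarrow> \<bar>w x\<bar> \<le> C" for w C
    by (rule Bochner_Integration.integrable_bound[OF integrable_mult_right[OF et, of C]])
      (use that in \<open>auto simp: abs_mult intro!: AE_I2 mult_right_mono intro: order_trans[OF _ abs_ge_self]\<close>)
  have gd: "integrable disk_measure (\<lambda>x. g x \<bullet> d x)"
    by (rule Bochner_Integration.integrable_bound[OF L2_integrable_mult[OF L2_norm[OF L(2)] L2_norm[OF LT(2)]]])
      (auto intro!: AE_I2 simp: Cauchy_Schwarz_ineq2)
  have "integrable disk_measure (\<lambda>x. (2 * K x * \<phi> x) * exp (u x))"
    by (rule bdd[of _ "2 * C1 * B"])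
      (use b C1 in \<open>auto simp: abs_mult intro!: mult_mono order_trans[OF abs_ge_zero C1]\<close>)
  then have "integrable disk_measure (\<lambda>x. 2 * K x * exp (u x) * \<phi> x)" by (simp add: ac_simps)
  with gd show i1: "integrable disk_measure (\<lambda>x. g x \<bullet> d x - 2 * K x * exp (u x) * \<phi> x)"
    by (rule Bochner_Integration.integrable_diff)
  have "integrable circle_measure (\<lambda>x. (2 * h x * \<sigma> x) * exp (\<tau> x / 2))"
    by (rule bdc[of _ "2 * C2 * B"])
      (use b C2 in \<open>auto simp: abs_mult intro!: mult_mono order_trans[OF abs_ge_zero C2]\<close>)
  then have "integrable circle_measure (\<lambda>x. 2 * h x * exp (\<tau> x / 2) * \<sigma> x)" by (simp add: ac_simps)
  then show i2: "integrable circle_measure (\<lambda>x. 2 * \<sigma> x - 2 * h x * exp (\<tau> x / 2) * \<sigma> x)"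
    using circle.L2_integrable[OF LT(3)] by simp
  have D1: "((\<lambda>t. \<integral>x. (norm (g x + t *\<^sub>R d x))\<^sup>2 / 2 - 2 * K x * exp (u x + t * \<phi> x) \<partial>disk_measure)
      has_real_derivative (\<integral>x. g x \<bullet> d x - 2 * K x * exp (u x) * \<phi> x \<partial>disk_measure)) (at 0)"
  proof (rule has_real_derivative_integral)
    have "integrable disk_measure (\<lambda>x. (2 * K x) * exp (u x))"
      by (rule bdd[of _ "2 * C1"]) (use C1 in \<open>auto simp: abs_mult\<close>)
    then show "integrable disk_measure (\<lambda>x. (norm (g x + 0 *\<^sub>R d x))\<^sup>2 / 2 - 2 * K x * exp (u x + 0 * \<phi> x))"
      using L2_integrable_norm_sq[OF L(2)] by simp
    show "integrable disk_measure (\<lambda>x. (norm (d x))\<^sup>2 / 2 + 2 * C1 * B\<^sup>2 * exp B * exp (u x))"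
      using L2_integrable_norm_sq[OF LT(2)] eu by simp
    fix t x assume x: "x \<in> space disk_measure" and t: "\<bar>t\<bar> \<le> (1::real)"
    have "(norm (g x + t *\<^sub>R d x))\<^sup>2 = (norm (g x))\<^sup>2 + 2 * (t * (g x \<bullet> d x)) + t\<^sup>2 * (norm (d x))\<^sup>2"
      unfolding power2_norm_eq_inner
      by (simp add: inner_add_left inner_add_right inner_commute power2_eq_square algebra_simps)
    then have n: "(norm (g x + t *\<^sub>R d x))\<^sup>2 / 2 - (norm (g x))\<^sup>2 / 2 - t * (g x \<bullet> d x) = t\<^sup>2 * ((norm (d x))\<^sup>2 / 2)"
      by linarith
    have e: "\<bar>2 * K x * exp (u x + t * \<phi> x) - 2 * K x * exp (u x) - t * (2 * K x * exp (u x) * \<phi> x)\<bar>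
        \<le> t\<^sup>2 * (2 * C1 * B\<^sup>2 * exp B * exp (u x))"
      by (rule exp_perturbation_bound) (use x t b C1[of x] in \<open>auto simp: abs_mult\<close>)
    have "(norm (g x + t *\<^sub>R d x))\<^sup>2 / 2 - 2 * K x * exp (u x + t * \<phi> x) -
        ((norm (g x + 0 *\<^sub>R d x))\<^sup>2 / 2 - 2 * K x * exp (u x + 0 * \<phi> x)) -
        t * (g x \<bullet> d x - 2 * K x * exp (u x) * \<phi> x) =
      t\<^sup>2 * ((norm (d x))\<^sup>2 / 2) -
        (2 * K x * exp (u x + t * \<phi> x) - 2 * K x * exp (u x) - t * (2 * K x * exp (u x) * \<phi> x))"
      using n by (simp add: algebra_simps)
    also have "\<bar>\<dots>\<bar> \<le> t\<^sup>2 * ((norm (d x))\<^sup>2 / 2) + t\<^sup>2 * (2 * C1 * B\<^sup>2 * exp B * exp (u x))"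
      by (rule order_trans[OF abs_triangle_ineq4 add_mono[OF _ e]]) simp
    finally show "\<bar>(norm (g x + t *\<^sub>R d x))\<^sup>2 / 2 - 2 * K x * exp (u x + t * \<phi> x) -
        ((norm (g x + 0 *\<^sub>R d x))\<^sup>2 / 2 - 2 * K x * exp (u x + 0 * \<phi> x)) -
        t * (g x \<bullet> d x - 2 * K x * exp (u x) * \<phi> x)\<bar> \<le>
      t\<^sup>2 * ((norm (d x))\<^sup>2 / 2 + 2 * C1 * B\<^sup>2 * exp B * exp (u x))"
      by (simp only: distrib_left)
  qed (measurable, fact i1)
  have D2: "((\<lambda>t. \<integral>x. 2 * (\<tau> x + t * \<sigma> x) - 4 * h x * exp ((\<tau> x + t * \<sigma> x) / 2) \<partial>circle_measure)
      has_real_derivative (\<integral>x. 2 * \<sigma> x - 2 * h x * exp (\<tau> x / 2) * \<sigma> x \<partial>circle_measure)) (at 0)"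
  proof (rule has_real_derivative_integral)
    have "integrable circle_measure (\<lambda>x. (4 * h x) * exp (\<tau> x / 2))"
      by (rule bdc[of _ "4 * C2"]) (use C2 in \<open>auto simp: abs_mult\<close>)
    then show "integrable circle_measure (\<lambda>x. 2 * (\<tau> x + 0 * \<sigma> x) - 4 * h x * exp ((\<tau> x + 0 * \<sigma> x) / 2))"
      using circle.L2_integrable[OF L(3)] by simp
    show "integrable circle_measure (\<lambda>x. 4 * C2 * B\<^sup>2 * exp B * exp (\<tau> x / 2))"
      using et by simp
    fix t x assume x: "x \<in> space circle_measure" and t: "\<bar>t\<bar> \<le> (1::real)"
    have e: "\<bar>4 * h x * exp (\<tau> x / 2 + t * (\<sigma> x / 2)) - 4 * h x * exp (\<tau> x / 2) - t * (4 * h x * exp (\<tau> x / 2) * (\<sigma> x / 2))\<bar>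
        \<le> t\<^sup>2 * (4 * C2 * B\<^sup>2 * exp B * exp (\<tau> x / 2))"
      by (rule exp_perturbation_bound)
        (use x t C2[of x] b(2)[of x] order_trans[OF abs_ge_zero b(2)[of x]] in \<open>auto simp: abs_mult\<close>)
    have "2 * (\<tau> x + t * \<sigma> x) - 4 * h x * exp ((\<tau> x + t * \<sigma> x) / 2) -
        (2 * (\<tau> x + 0 * \<sigma> x) - 4 * h x * exp ((\<tau> x + 0 * \<sigma> x) / 2)) -
        t * (2 * \<sigma> x - 2 * h x * exp (\<tau> x / 2) * \<sigma> x) =
      - (4 * h x * exp (\<tau> x / 2 + t * (\<sigma> x / 2)) - 4 * h x * exp (\<tau> x / 2) - t * (4 * h x * exp (\<tau> x / 2) * (\<sigma> x / 2)))"
      by (simp add: add_divide_distrib algebra_simps)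
    then show "\<bar>2 * (\<tau> x + t * \<sigma> x) - 4 * h x * exp ((\<tau> x + t * \<sigma> x) / 2) -
        (2 * (\<tau> x + 0 * \<sigma> x) - 4 * h x * exp ((\<tau> x + 0 * \<sigma> x) / 2)) -
        t * (2 * \<sigma> x - 2 * h x * exp (\<tau> x / 2) * \<sigma> x)\<bar> \<le>
      t\<^sup>2 * (4 * C2 * B\<^sup>2 * exp B * exp (\<tau> x / 2))"
      using e by (simp only: abs_minus)
  qed (measurable, fact i2)
  from DERIV_unique[OF DERIV_add[OF D1 D2] crit[unfolded energy_def]]
  show "(\<integral>x. g x \<bullet> d x - 2 * K x * exp (u x) * \<phi> x \<partial>disk_measure) +
      (\<integral>x. 2 * \<sigma> x - 2 * h x * exp (\<tau> x / 2) * \<sigma> x \<partial>circle_measure) = 0" .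
qed

lemma holder_continuous_on_imp_continuous_on:
  assumes "holder_continuous_on S f"
  shows "continuous_on S f"
proof -
  obtain \<alpha> C where \<alpha>: "0 < \<alpha>" and C: "\<And>x y. x \<in> S \<Longrightarrow> y \<in> S \<Longrightarrow> \<bar>f x - f y\<bar> \<le> C * dist x y powr \<alpha>"
    using assms by (auto simp: holder_continuous_on_def)
  show ?thesis
    unfolding continuous_on_def
  proof
    fix x assume x: "x \<in> S"
    have "((\<lambda>y. dist y x) \<longlongrightarrow> dist x x) (at x within S)" by (intro tendsto_intros)
    then have "((\<lambda>y. C * dist y x powr \<alpha>) \<longlongrightarrow> C * 0) (at x within S)"
      using \<alpha> by (intro tendsto_mult_left tendsto_zero_powrI[of _ _ _ \<alpha>]) auto
    then have "((\<lambda>y. f y - f x) \<longlongrightarrow> 0) (at x within S)"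
      using C x by (intro Lim_null_comparison[of "\<lambda>y. f y - f x" "\<lambda>y. C * dist y x powr \<alpha>"])
        (auto simp: eventually_at_filter intro!: always_eventually)
    then show "(f \<longlongrightarrow> f x) (at x within S)" by (rule LIM_zero_cancel)
  qed
qed

section \<open>Truncation\<close>

text \<open>The test function of the proof grows like \<open>e\<^bsup>u/2\<^esup>\<close>, and for a general \<open>u\<close> in
  \<open>H\<^sup>1\<close> its gradient need not be square-integrable. Truncating
  \<open>u\<close> inside it by a bounded increasing \<open>C\<^sup>1\<close> function repairs this; \<open>|trunc N y| \<le> |y|\<close>
  and \<open>0 < trunc_deriv N y \<le> 1\<close> give bounds independent of \<open>N\<close> for the passage to the limit.\<close>

definition trunc :: "real \<Rightarrow> real \<Rightarrow> real" where
  "trunc N y = N * arctan (y / N)"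

definition trunc_deriv :: "real \<Rightarrow> real \<Rightarrow> real" where
  "trunc_deriv N y = 1 / (1 + (y / N)\<^sup>2)"

lemma trunc_deriv_bounds: "0 < trunc_deriv N y" "trunc_deriv N y \<le> 1"
  by (auto simp: trunc_deriv_def divide_le_eq_1 add_pos_nonneg)

lemma DERIV_trunc:
  assumes "N > 0"
  shows "(trunc N has_real_derivative trunc_deriv N y) (at y)"
proof -
  have "((\<lambda>y. arctan (y / N)) has_real_derivative inverse (1 + (y / N)\<^sup>2) * (1 / N)) (at y)"
    by (rule DERIV_chain2[OF DERIV_arctan DERIV_cdivide[OF DERIV_ident]])
  from DERIV_cmult[OF this, of N] show ?thesis
    using assms by (simp add: trunc_def[abs_def] trunc_deriv_def inverse_eq_divide)
qed

lemma continuous_on_trunc [continuous_intros]: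
  assumes "N > 0" "continuous_on A f"
  shows "continuous_on A (\<lambda>x. trunc N (f x))" "continuous_on A (\<lambda>x. trunc_deriv N (f x))"
proof -
  have "1 + (f x / N)\<^sup>2 \<noteq> 0" for x by (metis add_pos_nonneg less_irrefl zero_le_power2 zero_less_one)
  then show "continuous_on A (\<lambda>x. trunc N (f x))" "continuous_on A (\<lambda>x. trunc_deriv N (f x))"
    unfolding trunc_def trunc_deriv_def using assms by (auto intro!: continuous_intros)
qed

lemma trunc_bounds:
  assumes "N > 0"
  shows "\<bar>trunc N y\<bar> \<le> \<bar>y\<bar>" "\<bar>trunc N y\<bar> \<le> N * pi"
proof -
  have "\<bar>arctan z\<bar> \<le> pi" for z
    using arctan_bounded[of z] pi_gt_zero by linarith
  then show "\<bar>trunc N y\<bar> \<le> N * pi"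
    using assms by (simp add: trunc_def abs_mult)
  have "\<bar>arctan z\<bar> \<le> \<bar>z\<bar>" for z
    by (rule abs_arctan_le)
  from mult_left_mono[OF this, of N "y/N"] show "\<bar>trunc N y\<bar> \<le> \<bar>y\<bar>"
    using assms by (simp add: trunc_def abs_mult)
qed

lemma trunc_tendsto:
  "(\<lambda>n. trunc (real (Suc n)) y) \<longlonglongrightarrow> y" "(\<lambda>n. trunc_deriv (real (Suc n)) y) \<longlonglongrightarrow> 1"
proof -
  have z: "(\<lambda>n. y / real (Suc n)) \<longlonglongrightarrow> 0"
    by (rule LIMSEQ_Suc) (rule lim_const_over_n)
  have "(\<lambda>n. 1 / (1 + (y / real (Suc n))\<^sup>2)) \<longlonglongrightarrow> 1 / (1 + 0\<^sup>2)"
    by (intro tendsto_intros z) auto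
  then show "(\<lambda>n. trunc_deriv (real (Suc n)) y) \<longlonglongrightarrow> 1"
    by (simp add: trunc_deriv_def)
  show "(\<lambda>n. trunc (real (Suc n)) y) \<longlonglongrightarrow> y"
  proof (cases "y = 0")
    case True then show ?thesis by (simp add: trunc_def)
  next
    case False
    have "(arctan has_real_derivative 1) (at 0)"
      using DERIV_arctan[of 0] by simp
    then have "((\<lambda>h. arctan h / h) \<longlongrightarrow> 1) (at 0)"
      by (simp add: DERIV_def)
    moreover have "filterlim (\<lambda>n. y / real (Suc n)) (at 0) sequentially"
      using z False by (simp add: filterlim_at)
    ultimately have "(\<lambda>n. arctan (y / real (Suc n)) / (y / real (Suc n))) \<longlonglongrightarrow> 1"
      by (rule filterlim_compose)
    then have "(\<lambda>n. y * (arctan (y / real (Suc n)) / (y / real (Suc n)))) \<longlonglongrightarrow> y * 1"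
      by (rule tendsto_mult_left)
    moreover have "y * (arctan (y / real (Suc n)) / (y / real (Suc n))) = trunc (real (Suc n)) y" for n
      using False by (simp add: trunc_def)
    ultimately show ?thesis by simp
  qed
qed

text \<open>After truncation the first argument of \<open>\<Theta>\<close> stays in a compact interval, so the chain rule applies
  to every continuously differentiable \<open>\<Theta>\<close>, however fast it grows.\<close>

lemma H1_trace_compose_trunc:
  fixes \<Theta> P :: "real \<Rightarrow> real \<times> real \<Rightarrow> real" and Q :: "real \<Rightarrow> real \<times> real \<Rightarrow> real \<times> real"
  assumes H: "H1_trace u g \<tau>" and N: "N > 0"
    and der: "\<And>y x. ((\<lambda>(y, x). \<Theta> y x) has_derivative (\<lambda>(s, k). s * P y x + k \<bullet> Q y x)) (at (y, x))"
    and cP: "continuous_on UNIV (\<lambda>(y, x). P y x)" and cQ: "continuous_on UNIV (\<lambda>(y, x). Q y x)"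
  shows "H1_trace (\<lambda>x. \<Theta> (trunc N (u x)) x)
      (\<lambda>x. (P (trunc N (u x)) x * trunc_deriv N (u x)) *\<^sub>R g x + Q (trunc N (u x)) x)
      (\<lambda>x. \<Theta> (trunc N (\<tau> x)) x)"
    and "\<exists>B. \<forall>y. \<forall>x\<in>unit_disk. \<bar>\<Theta> (trunc N y) x\<bar> \<le> B"
proof -
  have c\<Theta>: "continuous_on UNIV (\<lambda>(y, x). \<Theta> y x)"
    using der by (intro differentiable_imp_continuous_on)
      (auto simp: differentiable_on_def differentiable_def intro: has_derivative_at_withinI)
  let ?S = "{- (N * pi)..N * pi} \<times> unit_disk"
  have S: "compact ?S" by (intro compact_Times compact_Icc compact_cball)
  have mem: "(trunc N y, x) \<in> ?S" if "x \<in> unit_disk" for x y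
    using trunc_bounds(2)[OF N, of y] that by (auto simp: abs_le_iff)
  have bd: "\<exists>C. \<forall>p\<in>?S. norm (f p) \<le> C" if "continuous_on UNIV f" for f :: "real \<times> real \<times> real \<Rightarrow> 'b::euclidean_space"
  proof -
    have "bounded (f ` ?S)"
      by (intro compact_imp_bounded compact_continuous_image S continuous_on_subset[OF that]) simp
    then show ?thesis unfolding bounded_iff by blast
  qed
  obtain C1 C2 C3 where C: "\<forall>p\<in>?S. norm ((\<lambda>(y, x). \<Theta> y x) p) \<le> C1"
      "\<forall>p\<in>?S. norm ((\<lambda>(y, x). P y x) p) \<le> C2" "\<forall>p\<in>?S. norm ((\<lambda>(y, x). Q y x) p) \<le> C3"
    using bd[OF c\<Theta>] bd[OF cP] bd[OF cQ] by blast
  have C': "\<bar>\<Theta> (trunc N y) x\<bar> \<le> C1" "\<bar>P (trunc N y) x\<bar> \<le> C2" "norm (Q (trunc N y) x) \<le> C3"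
    if "x \<in> unit_disk" for x y
    using C[THEN bspec[OF _ mem[OF that, of y]]] by simp_all
  then show "\<exists>B. \<forall>y. \<forall>x\<in>unit_disk. \<bar>\<Theta> (trunc N y) x\<bar> \<le> B" by blast
  define B where "B = max C1 (max C2 C3)"
  show "H1_trace (\<lambda>x. \<Theta> (trunc N (u x)) x)
      (\<lambda>x. (P (trunc N (u x)) x * trunc_deriv N (u x)) *\<^sub>R g x + Q (trunc N (u x)) x)
      (\<lambda>x. \<Theta> (trunc N (\<tau> x)) x)"
  proof (rule H1_trace_compose[OF H, where \<Theta>="\<lambda>y. \<Theta> (trunc N y)" and P="\<lambda>y x. P (trunc N y) x * trunc_deriv N y"
        and Q="\<lambda>y. Q (trunc N y)" and C=B])
    fix y :: real and x :: "real \<times> real"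
    have "((\<lambda>p. (trunc N (fst p), snd p)) has_derivative (\<lambda>p. (trunc_deriv N y * fst p, snd p))) (at (y, x))"
    proof (intro has_derivative_Pair has_derivative_snd has_derivative_ident)
      have "(trunc N has_derivative (*) (trunc_deriv N y)) (at (fst (y, x)))"
        using DERIV_trunc[OF N, of y] by (simp add: has_field_derivative_def)
      from has_derivative_compose[OF has_derivative_fst[OF has_derivative_ident] this]
      show "((\<lambda>p. trunc N (fst p)) has_derivative (\<lambda>p. trunc_deriv N y * fst p)) (at (y, x))" .
    qed
    from has_derivative_compose[OF this, of "\<lambda>(y, x). \<Theta> y x" "\<lambda>(s, k). s * P (trunc N y) x + k \<bullet> Q (trunc N y) x"] der
    show "((\<lambda>(y, x). \<Theta> (trunc N y) x) has_derivative
        (\<lambda>(s, k). s * (P (trunc N y) x * trunc_deriv N y) + k \<bullet> Q (trunc N y) x)) (at (y, x))"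
      by (simp add: case_prod_unfold ac_simps)
    have cc: "continuous_on UNIV (\<lambda>p::real \<times> real \<times> real. (trunc N (fst p), snd p))"
      by (intro continuous_intros N)
    show "continuous_on UNIV (\<lambda>(y, x). P (trunc N y) x * trunc_deriv N y)"
      using continuous_on_compose2[OF cP cc] by (auto simp: case_prod_unfold intro!: continuous_intros N)
    show "continuous_on UNIV (\<lambda>(y, x). Q (trunc N y) x)"
      using continuous_on_compose2[OF cQ cc] by (auto simp: case_prod_unfold)
    assume x: "x \<in> unit_disk"
    show "\<bar>\<Theta> (trunc N y) x\<bar> \<le> B" "norm (Q (trunc N y) x) \<le> B"
      using C'[OF x, of y] by (auto simp: B_def)
    have "\<bar>P (trunc N y) x * trunc_deriv N y\<bar> \<le> \<bar>P (trunc N y) x\<bar>"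
      using trunc_deriv_bounds[of N y] by (simp add: abs_mult mult_left_le)
    then show "\<bar>P (trunc N y) x * trunc_deriv N y\<bar> \<le> B"
      using C'(2)[OF x, of y] by (simp add: B_def)
  qed
qed

section \<open>The test function\<close>

text \<open>With the notation of the introduction, \<open>\<Phi>(u, x) = coth q\<close>.
  The subscripts denote the partial derivatives in the two arguments.\<close>

definition \<Phi> :: "real \<Rightarrow> real \<Rightarrow> real \<times> real \<Rightarrow> real" where
  "\<Phi> c y x = sqrt (1 + c\<^sup>2 * (x \<bullet> x) * exp y)"

definition \<Phi>\<^sub>y :: "real \<Rightarrow> real \<Rightarrow> real \<times> real \<Rightarrow> real" where
  "\<Phi>\<^sub>y c y x = c\<^sup>2 * (x \<bullet> x) * exp y / (2 * \<Phi> c y x)"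

definition \<Phi>\<^sub>x :: "real \<Rightarrow> real \<Rightarrow> real \<times> real \<Rightarrow> real \<times> real" where
  "\<Phi>\<^sub>x c y x = (c\<^sup>2 * exp y / \<Phi> c y x) *\<^sub>R x"

text \<open>\<open>\<Gamma> x\<close> is the field \<open>2 (\<Phi>\<^sup>2 - \<Phi>) x / |x|\<^sup>2\<close>, written so that its smoothness at the origin
  is visible.\<close>

definition \<Gamma> :: "real \<Rightarrow> real \<Rightarrow> real \<times> real \<Rightarrow> real" where
  "\<Gamma> c y x = 2 * (c\<^sup>2 * exp y) - 2 * (c\<^sup>2 * exp y) / (1 + \<Phi> c y x)"

definition \<Gamma>\<^sub>y :: "real \<Rightarrow> real \<Rightarrow> real \<times> real \<Rightarrow> real" where
  "\<Gamma>\<^sub>y c y x = \<Gamma> c y x + 2 * (c\<^sup>2 * exp y) / (1 + \<Phi> c y x)\<^sup>2 * \<Phi>\<^sub>y c y x"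

definition \<Gamma>\<^sub>x :: "real \<Rightarrow> real \<Rightarrow> real \<times> real \<Rightarrow> real \<times> real" where
  "\<Gamma>\<^sub>x c y x = (2 * (c\<^sup>2 * exp y) / (1 + \<Phi> c y x)\<^sup>2) *\<^sub>R \<Phi>\<^sub>x c y x"

lemma \<Phi>_ge_1: "1 \<le> \<Phi> c y x"
  by (simp add: \<Phi>_def)

lemma \<Phi>_pos: "0 < \<Phi> c y x" "\<Phi> c y x \<noteq> 0" "1 + \<Phi> c y x \<noteq> 0"
  using \<Phi>_ge_1[of c y x] by auto

lemma \<Phi>_squared: "(\<Phi> c y x)\<^sup>2 = 1 + c\<^sup>2 * (x \<bullet> x) * exp y"
  unfolding \<Phi>_def by (intro real_sqrt_pow2 add_nonneg_nonneg mult_nonneg_nonneg) auto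

lemma \<Phi>_has_derivative:
  "((\<lambda>(y, x). \<Phi> c y x) has_derivative (\<lambda>(s, k). s * \<Phi>\<^sub>y c y x + k \<bullet> \<Phi>\<^sub>x c y x)) (at (y, x))"
proof -
  have pos: "0 < 1 + c\<^sup>2 * (x \<bullet> x) * exp y"
    by (intro add_pos_nonneg mult_nonneg_nonneg) auto
  have "((\<lambda>p. 1 + c\<^sup>2 * (snd p \<bullet> snd p) * exp (fst p)) has_derivative
      (\<lambda>p. c\<^sup>2 * (x \<bullet> x) * exp y * fst p + 2 * (c\<^sup>2 * exp y) * (snd p \<bullet> x))) (at (y, x))"
    by (auto intro!: derivative_eq_intros simp: inner_commute algebra_simps)
  from has_derivative_real_sqrt[of "\<lambda>p. 1 + c\<^sup>2 * (snd p \<bullet> snd p) * exp (fst p)", OF _ this] pos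
  have "((\<lambda>p. sqrt (1 + c\<^sup>2 * (snd p \<bullet> snd p) * exp (fst p))) has_derivative
      (\<lambda>p. inverse (sqrt (1 + c\<^sup>2 * (x \<bullet> x) * exp y)) / 2 *
        (c\<^sup>2 * (x \<bullet> x) * exp y * fst p + 2 * (c\<^sup>2 * exp y) * (snd p \<bullet> x)))) (at (y, x))"
    by (simp add: mult.commute)
  moreover have "(\<lambda>p. inverse (sqrt (1 + c\<^sup>2 * (x \<bullet> x) * exp y)) / 2 *
        (c\<^sup>2 * (x \<bullet> x) * exp y * fst p + 2 * (c\<^sup>2 * exp y) * (snd p \<bullet> x))) =
      (\<lambda>(s, k). s * \<Phi>\<^sub>y c y x + k \<bullet> \<Phi>\<^sub>x c y x)"
    unfolding \<Phi>_def[symmetric] \<Phi>\<^sub>y_def \<Phi>\<^sub>x_def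
    using \<Phi>_pos(2)[of c y x] by (auto simp: fun_eq_iff field_simps)
  ultimately show ?thesis
    by (simp add: case_prod_unfold \<Phi>_def)
qed

lemma continuous_on_\<Phi> [continuous_intros]:
  fixes f :: "'a::topological_space \<Rightarrow> real" and g :: "'a \<Rightarrow> real \<times> real"
  assumes "continuous_on A f" "continuous_on A g"
  shows "continuous_on A (\<lambda>p. \<Phi> c (f p) (g p))"
  unfolding \<Phi>_def using assms by (intro continuous_intros)

lemma \<Phi>_partials_continuous:
  "continuous_on UNIV (\<lambda>(y, x). \<Phi>\<^sub>y c y x)" "continuous_on UNIV (\<lambda>(y, x). \<Phi>\<^sub>x c y x)"
  "continuous_on UNIV (\<lambda>(y, x). \<Gamma>\<^sub>y c y x)" "continuous_on UNIV (\<lambda>(y, x). \<Gamma>\<^sub>x c y x)"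
  unfolding case_prod_unfold \<Phi>\<^sub>y_def \<Phi>\<^sub>x_def \<Gamma>\<^sub>y_def \<Gamma>\<^sub>x_def \<Gamma>_def
  by (intro continuous_intros; simp add: \<Phi>_pos)+

lemma \<Gamma>_has_derivative:
  "((\<lambda>(y, x). \<Gamma> c y x) has_derivative (\<lambda>(s, k). s * \<Gamma>\<^sub>y c y x + k \<bullet> \<Gamma>\<^sub>x c y x)) (at (y, x))"
proof -
  have \<Phi>': "((\<lambda>p. \<Phi> c (fst p) (snd p)) has_derivative (\<lambda>p. fst p * \<Phi>\<^sub>y c y x + snd p \<bullet> \<Phi>\<^sub>x c y x)) (at (y, x))"
    using \<Phi>_has_derivative[of c y x] by (simp add: case_prod_unfold)
  have E: "((\<lambda>p. 2 * (c\<^sup>2 * exp (fst p))) has_derivative (\<lambda>p. 2 * (c\<^sup>2 * exp y) * fst p)) (at (y, x))"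
    by (auto intro!: derivative_eq_intros)
  have I: "((\<lambda>p. inverse (1 + \<Phi> c (fst p) (snd p))) has_derivative
      (\<lambda>p. - (inverse (1 + \<Phi> c y x) * (fst p * \<Phi>\<^sub>y c y x + snd p \<bullet> \<Phi>\<^sub>x c y x) * inverse (1 + \<Phi> c y x))))
      (at (y, x))"
    using Deriv.has_derivative_inverse[OF _ has_derivative_add[OF has_derivative_const \<Phi>'], of 1] by (simp add: \<Phi>_pos)
  have "(\<lambda>p. 2 * (c\<^sup>2 * exp (fst p)) - 2 * (c\<^sup>2 * exp (fst p)) * inverse (1 + \<Phi> c (fst p) (snd p)))
      = (\<lambda>(y, x). \<Gamma> c y x)"
    by (simp add: fun_eq_iff \<Gamma>_def divide_inverse)
  moreover have "(\<lambda>p. 2 * (c\<^sup>2 * exp y) * fst p - (2 * (c\<^sup>2 * exp y) *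
        - (inverse (1 + \<Phi> c y x) * (fst p * \<Phi>\<^sub>y c y x + snd p \<bullet> \<Phi>\<^sub>x c y x) * inverse (1 + \<Phi> c y x)) +
        2 * (c\<^sup>2 * exp y) * fst p * inverse (1 + \<Phi> c y x))) =
      (\<lambda>(s, k). s * \<Gamma>\<^sub>y c y x + k \<bullet> \<Gamma>\<^sub>x c y x)"
    unfolding \<Gamma>\<^sub>y_def \<Gamma>\<^sub>x_def \<Gamma>_def divide_inverse power_inverse[symmetric]
    by (simp add: fun_eq_iff power2_eq_square algebra_simps)
  ultimately show ?thesis
    using has_derivative_diff[OF E has_derivative_mult[OF E I]] by simp
qed

text \<open>The divergence of \<open>\<Gamma>(u, x) x\<close>, with \<open>X\<close> standing for \<open>x \<bullet> \<nabla>u\<close>.\<close>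

lemma \<Gamma>_divergence:
  "2 * \<Gamma> c y x + (\<Gamma>\<^sub>y c y x * X + x \<bullet> \<Gamma>\<^sub>x c y x) = (2 - 1 / \<Phi> c y x) * (c\<^sup>2 * exp y) * (X + 2)"
proof -
  define F E r where "F = \<Phi> c y x" and "E = c\<^sup>2 * exp y" and "r = x \<bullet> x"
  have F: "F\<^sup>2 = 1 + E * r" unfolding F_def E_def r_def \<Phi>_squared by simp
  have p: "F \<noteq> 0" "1 + F \<noteq> 0" using \<Phi>_pos[of c y x] by (auto simp: F_def)
  have \<Gamma>: "\<Gamma> c y x = 2 * E - 2 * E / (1 + F)"
    by (simp add: \<Gamma>_def E_def F_def)
  have \<Phi>\<^sub>y: "\<Phi>\<^sub>y c y x = (F\<^sup>2 - 1) / (2 * F)" and \<Phi>\<^sub>x: "x \<bullet> \<Phi>\<^sub>x c y x = (F\<^sup>2 - 1) / F"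
    unfolding F by (simp_all add: \<Phi>\<^sub>y_def \<Phi>\<^sub>x_def F_def E_def r_def ac_simps)
  have \<Gamma>\<^sub>y: "\<Gamma>\<^sub>y c y x = (2 - 1 / F) * E"
    unfolding \<Gamma>\<^sub>y_def \<Gamma> \<Phi>\<^sub>y F_def[symmetric] E_def[symmetric]
    using p by (simp add: divide_simps) algebra
  have "x \<bullet> \<Gamma>\<^sub>x c y x = 2 * E / (1 + F)\<^sup>2 * (x \<bullet> \<Phi>\<^sub>x c y x)"
    by (simp add: \<Gamma>\<^sub>x_def E_def F_def)
  then have \<Gamma>\<^sub>x: "2 * \<Gamma> c y x + x \<bullet> \<Gamma>\<^sub>x c y x = 2 * (2 - 1 / F) * E"
    unfolding \<Phi>\<^sub>x \<Gamma> using p by (simp add: divide_simps) algebra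
  have "2 * \<Gamma> c y x + (\<Gamma>\<^sub>y c y x * X + x \<bullet> \<Gamma>\<^sub>x c y x) =
      2 * (2 - 1 / F) * E + (2 - 1 / F) * E * X"
    using \<Gamma>\<^sub>x unfolding \<Gamma>\<^sub>y by linarith
  also have "\<dots> = (2 - 1 / F) * E * (X + 2)"
    by (simp only: distrib_left mult.commute[of _ 2] mult.assoc add.commute)
  finally show ?thesis
    unfolding F_def[symmetric] E_def[symmetric] .
qed

lemma \<Gamma>_on_circle:
  assumes "x \<in> sphere 0 1"
  shows "\<Gamma> c y x = 2 * (\<Phi> c y x)\<^sup>2 - 2 * \<Phi> c y x"
proof -
  have "x \<bullet> x = 1" using assms by (simp add: dot_square_norm)
  then have "c\<^sup>2 * exp y = (\<Phi> c y x)\<^sup>2 - 1" by (simp add: \<Phi>_squared)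
  then show ?thesis
    unfolding \<Gamma>_def using \<Phi>_pos(3)[of c y x] by (simp add: field_simps) algebra
qed

text \<open>The integrand over the disk that results from testing the equation with \<open>\<Phi>(v, x)\<close>, replacing
  \<open>K\<close> by its upper bound \<open>- c\<^sup>2\<close>, and subtracting the divergence of \<open>\<Gamma>(v, x) x\<close>. Here
  \<open>v\<close> is the truncation of \<open>u\<close> and \<open>\<kappa>\<close> its derivative, so \<open>\<kappa> g\<close> is the gradient of
  \<open>v\<close>.\<close>

definition interior_density :: "real \<Rightarrow> real \<Rightarrow> real \<Rightarrow> real \<Rightarrow> real \<times> real \<Rightarrow> real \<times> real \<Rightarrow> real" where
  "interior_density c \<kappa> v u g x = g \<bullet> ((\<Phi>\<^sub>y c v x * \<kappa>) *\<^sub>R g + \<Phi>\<^sub>x c v x) + 2 * c\<^sup>2 * exp u * \<Phi> c v x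
    - (2 * \<Gamma> c v x + x \<bullet> ((\<Gamma>\<^sub>y c v x * \<kappa>) *\<^sub>R g + \<Gamma>\<^sub>x c v x))"

lemma interior_density_eq:
  "interior_density c \<kappa> v u g x = \<Phi>\<^sub>y c v x * \<kappa> * (norm g)\<^sup>2 + c\<^sup>2 * exp v / \<Phi> c v x * (x \<bullet> g)
    + 2 * c\<^sup>2 * exp u * \<Phi> c v x - (2 - 1 / \<Phi> c v x) * (c\<^sup>2 * exp v) * (\<kappa> * (x \<bullet> g) + 2)"
  using \<Gamma>_divergence[of c v x "\<kappa> * (x \<bullet> g)"]
  by (simp add: interior_density_def \<Phi>\<^sub>x_def inner_add_right power2_norm_eq_inner inner_commute ac_simps)

text \<open>Without truncation the density is, up to a positive factor, a sum of squares; \<open>|x|\<^sup>2 |g|\<^sup>2 - (x \<bullet> g)\<^sup>2\<close> is the square of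
  the angular derivative, and the other square vanishes for the hyperbolic comparison metrics.\<close>

lemma interior_density_nonneg: "0 \<le> interior_density c 1 u u g x"
proof -
  define F E X where "F = \<Phi> c u x" and "E = c\<^sup>2 * exp u" and "X = x \<bullet> g"
  have F: "F\<^sup>2 = 1 + E * (x \<bullet> x)" unfolding F_def E_def \<Phi>_squared by simp
  have p: "F > 0" using \<Phi>_pos[of c u x] by (auto simp: F_def)
  have "interior_density c 1 u u g x = E * (x \<bullet> x) / (2 * F) * (norm g)\<^sup>2 + E / F * X + 2 * E * F - (2 - 1 / F) * E * (X + 2)"
    unfolding interior_density_eq F_def E_def X_def \<Phi>\<^sub>y_def by (simp add: ac_simps)
  also have "\<dots> = E / (2 * F) * (((x \<bullet> x) * (norm g)\<^sup>2 - X\<^sup>2) + (X + 2 - 2 * F)\<^sup>2)"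
    using p by (simp add: field_simps power2_eq_square)
  also have "\<dots> \<ge> 0"
    using Cauchy_Schwarz_ineq[of x g] p
    by (intro mult_nonneg_nonneg add_nonneg_nonneg) (auto simp: E_def X_def power2_norm_eq_inner)
  finally show ?thesis .
qed

text \<open>The terms with \<open>|g|\<^sup>2\<close> and \<open>e\<^sup>u \<Phi>\<close> are nonnegative for every truncation; the others are at most linear in
  \<open>g\<close>. This bound does not depend on the truncation and is integrable, since \<open>e\<^bsup>|u|\<^esup>\<close> and
  \<open>g\<close> are in \<open>L\<^sup>2\<close>.\<close>

lemma interior_density_lower_bound:
  assumes x: "x \<in> unit_disk" and \<kappa>: "0 \<le> \<kappa>" "\<kappa> \<le> 1" and v: "\<bar>v\<bar> \<le> \<bar>u\<bar>"
  shows "- (c\<^sup>2 * exp \<bar>u\<bar> * (3 * norm g + 4)) \<le> interior_density c \<kappa> v u g x"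
proof -
  define F E X where "F = \<Phi> c v x" and "E = c\<^sup>2 * exp v" and "X = x \<bullet> g"
  have F: "F \<ge> 1" by (simp add: F_def \<Phi>_ge_1)
  have "E \<ge> 0" by (simp add: E_def)
  have X: "\<bar>X\<bar> \<le> norm g"
  proof -
    have "\<bar>X\<bar> \<le> norm x * norm g" unfolding X_def by (rule Cauchy_Schwarz_ineq2)
    also have "\<dots> \<le> 1 * norm g" using x by (intro mult_right_mono) auto
    finally show ?thesis by simp
  qed
  have 1: "- (E * norm g) \<le> E / F * X"
  proof -
    have "\<bar>E / F * X\<bar> \<le> E * norm g"
      unfolding abs_mult using F \<open>E \<ge> 0\<close> X
      by (intro mult_mono) (auto simp: divide_le_eq mult_le_cancel_left1)
    then show ?thesis by linarith
  qed
  have 2: "(2 - 1 / F) * E * (\<kappa> * X + 2) \<le> 2 * E * (norm g + 2)"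
  proof -
    have "\<bar>\<kappa> * X\<bar> \<le> 1 * norm g"
      unfolding abs_mult using \<kappa> X by (intro mult_mono) auto
    then have "\<bar>\<kappa> * X + 2\<bar> \<le> norm g + 2" by linarith
    moreover have "\<bar>2 - 1 / F\<bar> \<le> 2" using F by (simp add: abs_le_iff field_simps)
    ultimately have "\<bar>(2 - 1 / F) * E * (\<kappa> * X + 2)\<bar> \<le> 2 * E * (norm g + 2)"
      unfolding abs_mult using \<open>E \<ge> 0\<close> by (intro mult_mono) auto
    then show ?thesis by linarith
  qed
  have "E \<le> c\<^sup>2 * exp \<bar>u\<bar>" unfolding E_def using v by (intro mult_left_mono) auto
  then have "E * (3 * norm g + 4) \<le> c\<^sup>2 * exp \<bar>u\<bar> * (3 * norm g + 4)"
    by (intro mult_right_mono) auto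
  moreover have "0 \<le> \<Phi>\<^sub>y c v x * \<kappa> * (norm g)\<^sup>2"
    using \<kappa> F by (auto simp: \<Phi>\<^sub>y_def F_def intro!: mult_nonneg_nonneg divide_nonneg_nonneg)
  moreover have "0 \<le> 2 * c\<^sup>2 * exp u * \<Phi> c v x"
    using F by (auto simp: F_def)
  ultimately show ?thesis
    using 1 2 unfolding interior_density_eq F_def[symmetric] E_def[symmetric] X_def[symmetric]
    by (simp add: algebra_simps)
qed

section \<open>Nonexistence\<close>

text \<open>Testing with \<open>\<Phi>(trunc n u, x)\<close> and using the divergence theorem for \<open>\<Gamma>(trunc n u, x) x\<close> bounds an
  integral over the disk by one over the circle. In the limit the first has a nonnegative integrand and the
  second a negative one.\<close>

theorem no_critical_point:
  assumes K: "continuous_on unit_disk K" and h: "continuous_on (sphere 0 1) h"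
    and c: "c > 0" "\<And>x. x \<in> unit_disk \<Longrightarrow> K x \<le> - (c\<^sup>2)" "\<And>x. x \<in> sphere 0 1 \<Longrightarrow> h x \<le> c"
    and H: "H1_trace u g \<tau>"
    and crit: "\<And>\<phi> d \<sigma>. H1_trace \<phi> d \<sigma> \<Longrightarrow>
      ((\<lambda>t. energy K h (\<lambda>x. u x + t * \<phi> x) (\<lambda>x. g x + t *\<^sub>R d x) (\<lambda>x. \<tau> x + t * \<sigma> x))
        has_real_derivative 0) (at 0)"
  shows False
proof -
  note L = H1_trace_imp_L2[OF H]
  note eL = H1_exp_abs_integrable[OF H]
  note m = L[THEN L2_measurable]
  define v where "v n y = trunc (real (Suc n)) y" for n y
  define \<kappa> where "\<kappa> n y = trunc_deriv (real (Suc n)) y" for n y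
  have v_le: "\<bar>v n y\<bar> \<le> \<bar>y\<bar>" for n y
    unfolding v_def by (rule trunc_bounds) simp
  have \<kappa>: "0 \<le> \<kappa> n y" "\<kappa> n y \<le> 1" for n y
    unfolding \<kappa>_def using trunc_deriv_bounds[of "real (Suc n)" y] by simp_all
  have v_lim: "(\<lambda>n. v n y) \<longlonglongrightarrow> y" and \<kappa>_lim: "(\<lambda>n. \<kappa> n y) \<longlonglongrightarrow> 1" for y
    unfolding v_def \<kappa>_def by (rule trunc_tendsto)+
  \<comment> \<open>Integrands over the disk and over the circle at truncation level \<open>n\<close>; the second is what
    \<open>h \<le> c\<close> and the value of \<open>\<Gamma>\<close> on the circle leave of the boundary terms.\<close>
  let ?J = "\<lambda>n x. interior_density c (\<kappa> n (u x)) (v n (u x)) (u x) (g x) x"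
  let ?b = "\<lambda>n x. 2 * (c * exp (\<tau> x / 2)) * \<Phi> c (v n (\<tau> x)) x - 2 * (\<Phi> c (v n (\<tau> x)) x)\<^sup>2"
  let ?q = "\<lambda>x. (4 * c + 2) * (1 + c\<^sup>2) * exp \<bar>\<tau> x\<bar>"
  have qi: "integrable circle_measure ?q" by (intro integrable_mult_right eL)
  have bq: "\<bar>2 * (c * exp (t / 2)) * \<Phi> c w x - 2 * (\<Phi> c w x)\<^sup>2\<bar> \<le> (4 * c + 2) * (1 + c\<^sup>2) * exp \<bar>t\<bar>"
    if x: "x \<in> sphere 0 1" and w: "\<bar>w\<bar> \<le> \<bar>t\<bar>" for x w t
  proof -
    have "x \<bullet> x = 1" using x by (simp add: dot_square_norm)
    then have sq: "(\<Phi> c w x)\<^sup>2 = 1 + c\<^sup>2 * exp w" by (simp add: \<Phi>_squared)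
    also have "\<dots> \<le> exp \<bar>t\<bar> + c\<^sup>2 * exp \<bar>t\<bar>"
      using w by (intro add_mono mult_left_mono) auto
    finally have sq_le: "(\<Phi> c w x)\<^sup>2 \<le> (1 + c\<^sup>2) * exp \<bar>t\<bar>" by (simp add: algebra_simps)
    have "(exp (t / 2))\<^sup>2 = exp t" by (simp add: power2_eq_square flip: exp_add)
    also have "\<dots> \<le> (1 + c\<^sup>2) * exp \<bar>t\<bar>"
      using mult_mono[of 1 "1 + c\<^sup>2" "exp t" "exp \<bar>t\<bar>"] by simp
    finally have "(exp (t / 2))\<^sup>2 \<le> (1 + c\<^sup>2) * exp \<bar>t\<bar>" .
    moreover have "2 * (exp (t / 2) * \<Phi> c w x) \<le> (exp (t / 2))\<^sup>2 + (\<Phi> c w x)\<^sup>2"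
      using zero_le_power2[of "exp (t / 2) - \<Phi> c w x"] by (simp add: power2_diff)
    ultimately have "2 * (exp (t / 2) * \<Phi> c w x) \<le> 2 * ((1 + c\<^sup>2) * exp \<bar>t\<bar>)"
      using sq_le by linarith
    from mult_left_mono[OF this, of c] c(1)
    have "2 * (c * exp (t / 2)) * \<Phi> c w x \<le> 2 * c * ((1 + c\<^sup>2) * exp \<bar>t\<bar>)"
      by (simp add: algebra_simps)
    moreover have "0 \<le> 2 * (c * exp (t / 2)) * \<Phi> c w x"
      using c(1) \<Phi>_pos(1)[of c w x] by simp
    moreover have "0 \<le> c * ((1 + c\<^sup>2) * exp \<bar>t\<bar>)" using c(1) by simp
    moreover have "(4 * c + 2) * (1 + c\<^sup>2) * exp \<bar>t\<bar> = 4 * (c * ((1 + c\<^sup>2) * exp \<bar>t\<bar>)) + 2 * ((1 + c\<^sup>2) * exp \<bar>t\<bar>)"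
      by (simp add: algebra_simps)
    moreover have "2 * c * ((1 + c\<^sup>2) * exp \<bar>t\<bar>) = 2 * (c * ((1 + c\<^sup>2) * exp \<bar>t\<bar>))" by simp
    ultimately show ?thesis
      using sq_le zero_le_power2[of "\<Phi> c w x"] by linarith
  qed
  have id: "(\<lambda>x. x) \<in> borel_measurable disk_measure" "(\<lambda>x. x) \<in> borel_measurable circle_measure"
    by (intro measurable_disk_continuous measurable_circle_continuous continuous_intros)+
  have \<Phi>_cont: "continuous_on UNIV (\<lambda>(y, x). \<Phi> c (v n y) x)" for n
    unfolding case_prod_unfold v_def by (intro continuous_intros) simp
  have bm: "?b n \<in> borel_measurable circle_measure" for n
    using measurable_compose_continuous[OF \<Phi>_cont m(3) id(2)] m(3) by measurable
  have bi: "integrable circle_measure (?b n)" for n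
    by (rule Bochner_Integration.integrable_bound[OF qi bm])
      (auto intro!: AE_I2 order_trans[OF bq abs_ge_self] v_le)

  have step: "integrable disk_measure (?J n) \<and> (\<integral>x. ?J n x \<partial>disk_measure) \<le> (\<integral>x. ?b n x \<partial>circle_measure)" for n
  proof -
    let ?N = "real (Suc n)"
    have N: "?N > 0" by simp
    let ?\<phi> = "\<lambda>x. \<Phi> c (v n (u x)) x" and ?\<sigma> = "\<lambda>x. \<Phi> c (v n (\<tau> x)) x"
    let ?d = "\<lambda>x. (\<Phi>\<^sub>y c (v n (u x)) x * \<kappa> n (u x)) *\<^sub>R g x + \<Phi>\<^sub>x c (v n (u x)) x"
    let ?\<gamma> = "\<lambda>x. \<Gamma> c (v n (u x)) x" and ?s = "\<lambda>x. \<Gamma> c (v n (\<tau> x)) x"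
    let ?e = "\<lambda>x. (\<Gamma>\<^sub>y c (v n (u x)) x * \<kappa> n (u x)) *\<^sub>R g x + \<Gamma>\<^sub>x c (v n (u x)) x"
    have T: "H1_trace ?\<phi> ?d ?\<sigma>"
      using H1_trace_compose_trunc(1)[OF H N \<Phi>_has_derivative \<Phi>_partials_continuous(1,2)]
      by (simp only: v_def \<kappa>_def)
    obtain B where B: "\<forall>y. \<forall>x\<in>unit_disk. \<bar>\<Phi> c (v n y) x\<bar> \<le> B"
      using H1_trace_compose_trunc(2)[OF H N \<Phi>_has_derivative \<Phi>_partials_continuous(1,2)]
      unfolding v_def by blast
    have D: "H1_trace ?\<gamma> ?e ?s"
      using H1_trace_compose_trunc(1)[OF H N \<Gamma>_has_derivative \<Phi>_partials_continuous(3,4)]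
      by (simp only: v_def \<kappa>_def)
    have bd: "\<bar>?\<phi> x\<bar> \<le> B" if "x \<in> unit_disk" for x using B that by blast
    have bc: "\<bar>?\<sigma> x\<bar> \<le> B" if "x \<in> sphere 0 1" for x
    proof -
      have "x \<in> unit_disk" using that by simp
      then show ?thesis using B by blast
    qed
    let ?l = "\<lambda>x. g x \<bullet> ?d x - 2 * K x * exp (u x) * ?\<phi> x"
    let ?r = "\<lambda>x. 2 * ?\<sigma> x - 2 * h x * exp (\<tau> x / 2) * ?\<sigma> x"
    have W: "integrable disk_measure ?l" "integrable circle_measure ?r"
      "(\<integral>x. ?l x \<partial>disk_measure) + (\<integral>x. ?r x \<partial>circle_measure) = 0"
      by (rule weak_equation[OF K h H T bd bc crit[OF T]]; assumption)+
    let ?div = "\<lambda>x. 2 * ?\<gamma> x + x \<bullet> ?e x"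
    have DL: "integrable disk_measure ?\<gamma>" "integrable circle_measure ?s"
      using disk.L2_integrable[OF H1_trace_imp_L2(1)[OF D]] circle.L2_integrable[OF H1_trace_imp_L2(3)[OF D]] .
    have divi: "integrable disk_measure ?div"
      by (intro Bochner_Integration.integrable_add integrable_mult_right DL radial_divergence_H1(1)[OF D])
    have gd: "integrable disk_measure (\<lambda>x. g x \<bullet> ?d x)"
      by (rule Bochner_Integration.integrable_bound[OF L2_integrable_mult[OF L2_norm[OF L(2)] L2_norm[OF H1_trace_imp_L2(2)[OF T]]]])
        (use m(2) L2_measurable[OF H1_trace_imp_L2(2)[OF T]] in \<open>auto intro!: AE_I2 simp: Cauchy_Schwarz_ineq2\<close>)
    have eu: "L2 disk_measure (\<lambda>x. exp (u x))"
      by (rule L2_bound[OF eL(1), of _ 1]) (use m(1) in auto)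
    have "integrable disk_measure (\<lambda>x. 2 * c\<^sup>2 * (exp (u x) * ?\<phi> x))"
      by (intro integrable_mult_right L2_integrable_mult eu H1_trace_imp_L2(1)[OF T])
    then have "integrable disk_measure (\<lambda>x. 2 * c\<^sup>2 * exp (u x) * ?\<phi> x)" by (simp only: mult.assoc)
    then have Ji: "integrable disk_measure (?J n)"
      unfolding interior_density_def
      by (intro Bochner_Integration.integrable_add Bochner_Integration.integrable_diff[OF _ divi] gd)
    have "(\<integral>x. ?J n x \<partial>disk_measure) \<le> (\<integral>x. ?l x - ?div x \<partial>disk_measure)"
    proof (rule integral_mono[OF Ji Bochner_Integration.integrable_diff[OF W(1) divi]])
      fix x assume "x \<in> space disk_measure"
      then have "K x \<le> - (c\<^sup>2)" by (intro c) simp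
      then have "(2 * exp (u x) * ?\<phi> x) * K x \<le> (2 * exp (u x) * ?\<phi> x) * (- (c\<^sup>2))"
        using \<Phi>_pos(1)[of c "v n (u x)" x] by (intro mult_left_mono) auto
      then show "?J n x \<le> ?l x - ?div x"
        unfolding interior_density_def by (simp add: ac_simps)
    qed
    also have "\<dots> = (\<integral>x. ?l x \<partial>disk_measure) - (\<integral>x. ?div x \<partial>disk_measure)"
      by (rule Bochner_Integration.integral_diff[OF W(1) divi])
    also have "\<dots> = - (\<integral>x. ?r x \<partial>circle_measure) - (\<integral>x. ?s x \<partial>circle_measure)"
      using W(3) radial_divergence_H1(2)[OF D] by linarith
    also have "\<dots> = (\<integral>x. - ?r x - ?s x \<partial>circle_measure)"
      by (simp only: Bochner_Integration.integral_diff[OF integrable_minus[OF W(2)] DL(2)] integral_minus)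
    also have "\<dots> \<le> (\<integral>x. ?b n x \<partial>circle_measure)"
    proof (rule integral_mono[OF _ bi])
      show "integrable circle_measure (\<lambda>x. - ?r x - ?s x)"
        by (rule Bochner_Integration.integrable_diff[OF integrable_minus[OF W(2)] DL(2)])
      fix x assume "x \<in> space circle_measure"
      then have x: "x \<in> sphere 0 1" by simp
      have "(2 * exp (\<tau> x / 2) * ?\<sigma> x) * h x \<le> (2 * exp (\<tau> x / 2) * ?\<sigma> x) * c"
        using \<Phi>_pos(1)[of c "v n (\<tau> x)" x] by (intro mult_left_mono c x) auto
      then show "- ?r x - ?s x \<le> ?b n x"
        unfolding \<Gamma>_on_circle[OF x] by (simp add: ac_simps)
    qed
    finally show ?thesis using Ji by blast
  qed

  \<comment> \<open>Only the negative parts of the interior integrands are dominated. They tend to \<open>0\<close>, as the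
    limit integrand is nonnegative, and this is all that is needed for a lower bound.\<close>
  have J_lim: "(\<lambda>n. ?J n x) \<longlonglongrightarrow> interior_density c 1 (u x) (u x) (g x) x" for x
  proof -
    have \<Phi>_lim: "(\<lambda>n. \<Phi> c (v n y) x) \<longlonglongrightarrow> \<Phi> c y x" for y
      unfolding \<Phi>_def by (intro tendsto_intros v_lim)
    show ?thesis
      unfolding interior_density_eq \<Phi>\<^sub>y_def
      by (intro tendsto_intros v_lim \<kappa>_lim \<Phi>_lim) (simp_all add: \<Phi>_pos)
  qed
  have "(\<lambda>n. \<integral>x. min (?J n x) 0 \<partial>disk_measure) \<longlonglongrightarrow> (\<integral>x. 0 \<partial>disk_measure)"
  proof (rule integral_dominated_convergence)
    have "L2 disk_measure (\<lambda>x. 3 *\<^sub>R norm (g x) + 4)"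
      by (intro L2_add L2_scaleR L2_norm L disk.L2_bounded[of _ 4]) auto
    from integrable_mult_right[OF L2_integrable_mult[OF eL(1) this], of "c\<^sup>2"]
    show "integrable disk_measure (\<lambda>x. c\<^sup>2 * exp \<bar>u x\<bar> * (3 * norm (g x) + 4))"
      by (simp add: mult.assoc)
    show "AE x in disk_measure. (\<lambda>n. min (?J n x) 0) \<longlonglongrightarrow> 0"
    proof (rule AE_I2)
      fix x
      have "(\<lambda>n. min (?J n x) 0) \<longlonglongrightarrow> min (interior_density c 1 (u x) (u x) (g x) x) 0"
        by (intro tendsto_min J_lim tendsto_const)
      then show "(\<lambda>n. min (?J n x) 0) \<longlonglongrightarrow> 0"
        using interior_density_nonneg[of c "u x" "g x" x] by (simp add: min_absorb2)
    qed
    show "AE x in disk_measure. norm (min (?J n x) 0) \<le> c\<^sup>2 * exp \<bar>u x\<bar> * (3 * norm (g x) + 4)" for n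
    proof (rule AE_I2)
      fix x assume "x \<in> space disk_measure"
      then have "- (c\<^sup>2 * exp \<bar>u x\<bar> * (3 * norm (g x) + 4)) \<le> ?J n x"
        by (intro interior_density_lower_bound \<kappa> v_le) simp
      moreover have "0 \<le> c\<^sup>2 * exp \<bar>u x\<bar> * (3 * norm (g x) + 4)"
        by (intro mult_nonneg_nonneg) auto
      ultimately show "norm (min (?J n x) 0) \<le> c\<^sup>2 * exp \<bar>u x\<bar> * (3 * norm (g x) + 4)"
        unfolding real_norm_def by linarith
    qed
    show "(\<lambda>x. min (?J n x) 0) \<in> borel_measurable disk_measure" for n
      using step[of n] by (intro borel_measurable_min) auto
  qed simp
  then have lim_J: "(\<lambda>n. \<integral>x. min (?J n x) 0 \<partial>disk_measure) \<longlonglongrightarrow> 0" by simp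

  \<comment> \<open>The boundary integrands are dominated by a multiple of \<open>e\<^bsup>|\<tau>|\<^esup>\<close>, and their limit is at
    most \<open>- 1\<close> because \<open>\<Phi>\<^sup>2 - z\<^sup>2 = 1\<close> on the circle.\<close>
  let ?blim = "\<lambda>x. 2 * (c * exp (\<tau> x / 2)) * \<Phi> c (\<tau> x) x - 2 * (\<Phi> c (\<tau> x) x)\<^sup>2"
  have bm_lim: "?blim \<in> borel_measurable circle_measure"
  proof -
    have "continuous_on UNIV (\<lambda>(y, x). \<Phi> c y x)"
      unfolding case_prod_unfold by (intro continuous_intros)
    from measurable_compose_continuous[OF this m(3) id(2)] m(3) show ?thesis by measurable
  qed
  have lim_b: "(\<lambda>n. \<integral>x. ?b n x \<partial>circle_measure) \<longlonglongrightarrow> (\<integral>x. ?blim x \<partial>circle_measure)"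
  proof (rule integral_dominated_convergence[OF bm_lim bm qi])
    show "AE x in circle_measure. (\<lambda>n. ?b n x) \<longlonglongrightarrow> ?blim x"
      unfolding \<Phi>_def by (intro AE_I2 tendsto_intros v_lim)
    show "AE x in circle_measure. norm (?b n x) \<le> ?q x" for n
      by (rule AE_I2) (simp only: real_norm_def space_circle_measure bq v_le)
  qed
  have "(\<integral>x. ?blim x \<partial>circle_measure) \<le> (\<integral>x. - 1 \<partial>circle_measure)"
  proof (rule integral_mono)
    show "integrable circle_measure ?blim"
      by (rule Bochner_Integration.integrable_bound[OF qi bm_lim])
        (auto intro!: AE_I2 order_trans[OF bq abs_ge_self])
    fix x assume "x \<in> space circle_measure"
    then have "x \<bullet> x = 1" by (simp add: dot_square_norm)
    define F z where "F = \<Phi> c (\<tau> x) x" and "z = c * exp (\<tau> x / 2)"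
    have "z\<^sup>2 = c\<^sup>2 * exp (\<tau> x)"
      by (simp add: z_def power_mult_distrib power2_eq_square flip: exp_add)
    then have F: "F\<^sup>2 = 1 + z\<^sup>2" using \<open>x \<bullet> x = 1\<close> by (simp add: F_def \<Phi>_squared)
    have "2 * z * F - 2 * F\<^sup>2 = - (F - z)\<^sup>2 - (F\<^sup>2 - z\<^sup>2)"
      by (simp add: power2_diff)
    also have "\<dots> \<le> - 1" using F by simp
    finally show "?blim x \<le> - 1" by (simp only: F_def z_def)
  qed simp
  also have "(\<integral>x. - 1 \<partial>circle_measure) = - (2 * pi)"
    using emeasure_circle_measure by (simp add: measure_def)
  finally have neg: "(\<integral>x. ?blim x \<partial>circle_measure) < 0"
    using pi_gt_zero by linarith
  have "(\<integral>x. min (?J n x) 0 \<partial>disk_measure) \<le> (\<integral>x. ?b n x \<partial>circle_measure)" for n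
  proof -
    have "(\<integral>x. min (?J n x) 0 \<partial>disk_measure) \<le> (\<integral>x. ?J n x \<partial>disk_measure)"
      using step[of n] by (intro integral_mono integrable_min) auto
    with step[of n] show ?thesis by linarith
  qed
  then have "0 \<le> (\<integral>x. ?blim x \<partial>circle_measure)"
    using LIMSEQ_le[OF lim_J lim_b] by blast
  with neg show False by linarith
qed

theorem theorem1p2:
  fixes K h :: "real \<times> real \<Rightarrow> real"
  assumes "continuous_on (cball 0 1) K"
    and "holder_continuous_on (sphere 0 1) h"
    and "\<exists>c\<^sub>0>0. (\<forall>x\<in>cball 0 1. K x \<le> - (c\<^sub>0\<^sup>2)) \<and> (\<forall>x\<in>sphere 0 1. h x \<le> c\<^sub>0)"
  shows "\<not> (\<exists>u. solution K h u)"
proof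
  assume "\<exists>u. solution K h u"
  then obtain u g \<tau> where H: "H1_trace u g \<tau>" and crit: "\<And>\<phi> d \<sigma>. H1_trace \<phi> d \<sigma> \<Longrightarrow>
      ((\<lambda>t. energy K h (\<lambda>x. u x + t * \<phi> x) (\<lambda>x. g x + t *\<^sub>R d x) (\<lambda>x. \<tau> x + t * \<sigma> x))
        has_real_derivative 0) (at 0)"
    unfolding solution_def by blast
  obtain c where "c > 0" "\<And>x. x \<in> cball 0 1 \<Longrightarrow> K x \<le> - (c\<^sup>2)" "\<And>x. x \<in> sphere 0 1 \<Longrightarrow> h x \<le> c"
    using assms(3) by blast
  from no_critical_point[OF assms(1) holder_continuous_on_imp_continuous_on[OF assms(2)] this H crit]
  show False .
qed

end
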